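(* For any infinite subset $S$ of $\mathbb Z(\sqrt{-1})$, the set \[F(S)=\left\{z\in U\setminus\mathbb Q(\sqrt{-1})\colon c_n(z)\in S\text{ for every } n\in\mathbb N\text{ and }\lim_{n\to\infty}|c_n(z)|=\infty\right\}\] is of Hausdorff dimension $\tau(|S|)/2$.
   Context: $\mathbb N=\{1,2,3,\ldots\}$. $\mathbb Q(\sqrt{-1})=\{x+\sqrt{-1}y\colon x,y\in\mathbb Q\}$ is the Gaussian field and $\mathbb Z(\sqrt{-1})=\{x+\sqrt{-1}y\colon x,y\in\mathbb Z\}$ is the ring of Gaussian integers. Let \[U=\left\{x+\sqrt{-1}y\in\mathbb C\colon -\tfrac12\le x<\tfrac12,\ -\tfrac12\le y<\tfrac12\right\}.\] For $x\in\mathbb R$, $\lfloor x\rfloor$ is the largest integer not exceeding $x$; for $z=x+\sqrt{-1}y\in\mathbb C$ with $x,y\in\mathbb R$, put $\lfloor z\rfloor=\lfloor x+\frac12\rfloor+\sqrt{-1}\lfloor y+\frac12\rfloor$. The Hurwitz map $H\colon U\setminus\{0\}\to U$ is $H(z)=\frac1z-\lfloor\frac1z\rfloor$. For $z\in U\setminus\{0\}$ the Hurwitz continued fraction digits are defined inductively by $c_n(z)=\lfloor 1/H^{n-1}(z)\rfloor$, $n\ge1$ (with $H^0(z)=z$); if $H^n(z)=0$ for some $n\geq 1$ then $c_{n+1}(z)$ is not defined. For $z\in U\setminus\mathbb Q(\sqrt{-1})$ one has $H^n(z)\ne0$ for every $n\geq 1$, so all digits $c_n(z)$, $n\in\mathbb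 N$, are defined. For $S\subset\mathbb Z(\sqrt{-1})$ let $|S|=\{|z|\colon z\in S\}$. The convergence exponent of an infinite set $B$ of nonnegative reals is \[\tau(B)=\inf\left\{t\ge0\colon\sum_{k\in B}k^{-t}<\infty\right\},\] where the term $k=0$, if present, is omitted from the sum. Hausdorff dimension is taken in $\mathbb C=\mathbb R^2$ with the Euclidean metric. *)

theory Defs
  imports "HOL-Analysis.Analysis"
begin

definition gaussian_field :: "complex set" where
  "gaussian_field = {Complex x y | x y. x \<in> \<rat> \<and> y \<in> \<rat>}"

definition gaussian_integers :: "complex set" where
  "gaussian_integers = {Complex x y | x y. x \<in> \<int> \<and> y \<in> \<int>}"

definition hurwitz_square :: "complex set" where
  "hurwitz_square = {z. -1/2 \<le> Re z \<and> Re z < 1/2 \<and> -1/2 \<le> Im z \<and> Im z < 1/2}"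

definition gauss_floor :: "complex \<Rightarrow> complex" where
  "gauss_floor z = Complex (of_int \<lfloor>Re z + 1/2\<rfloor>) (of_int \<lfloor>Im z + 1/2\<rfloor>)"

(* The Hurwitz map proper lives on the square without 0; as 1/0 = 0 in HOL, the total
   function below sends 0 to 0. This value is never reached from a point of the square
   outside the Gaussian field. *)
definition hurwitz_map :: "complex \<Rightarrow> complex" where
  "hurwitz_map z = 1 / z - gauss_floor (1 / z)"

(* Digits are indexed from n = 1. Index 0 carries no meaning, and neither does a digit at
   which the expansion of an element of the Gaussian field has already terminated. *)
definition hurwitz_digit :: "nat \<Rightarrow> complex \<Rightarrow> complex" where
  "hurwitz_digit n z = gauss_floor (1 / (hurwitz_map ^^ (n - 1)) z)"

definition hurwitz_F :: "complex set \<Rightarrow> complex set" where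
  "hurwitz_F S = {z \<in> hurwitz_square - gaussian_field.
     (\<forall>n\<ge>1. hurwitz_digit n z \<in> S) \<and>
     filterlim (\<lambda>n. cmod (hurwitz_digit n z)) at_top sequentially}"

(* The terms are nonnegative, so summability says that the sum is finite.
   The infimum is taken in [0, \<infinity>], with value \<infinity> if no exponent is admissible. *)
definition convergence_exponent :: "real set \<Rightarrow> ennreal" where
  "convergence_exponent B =
     (INF t \<in> {t. 0 \<le> t \<and> (\<lambda>k. k powr (- t)) summable_on (B - {0})}. ennreal t)"

(* diam(X)^s, with the convention 0^0 = 1 for nonempty X (powr would give 0). *)
definition diam_power :: "real \<Rightarrow> 'a::metric_space set \<Rightarrow> ennreal" where
  "diam_power s X =
     (if X = {} then 0 else if s = 0 then 1 else ennreal (diameter X powr s))"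

(* Boundedness is required because the library's diameter is only meaningful for
   bounded sets. Finite covers are included, as members of the cover may be empty. *)
definition hausdorff_premeasure :: "real \<Rightarrow> real \<Rightarrow> 'a::metric_space set \<Rightarrow> ennreal" where
  "hausdorff_premeasure s \<delta> A =
     (INF C \<in> {C :: nat \<Rightarrow> 'a set. A \<subseteq> (\<Union>i. C i) \<and>
                 (\<forall>i. bounded (C i) \<and> diameter (C i) \<le> \<delta>)}.
        \<Sum>i. diam_power s (C i))"

definition hausdorff_measure :: "real \<Rightarrow> 'a::metric_space set \<Rightarrow> ennreal" where
  "hausdorff_measure s A = (SUP \<delta> \<in> {0<..}. hausdorff_premeasure s \<delta> A)"

definition hausdorff_dim :: "'a::metric_space set \<Rightarrow> ennreal" where
  "hausdorff_dim A = (INF s \<in> {s. 0 \<le> s \<and> hausdorff_measure s A = 0}. ennreal s)"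

end

theory Submission
  imports Defs "HOL-Computational_Algebra.Primes" "HOL-Probability.Infinite_Product_Measure"
begin

text \<open>
  Write $\tau$ for the convergence exponent of the set of moduli of \<open>S\<close>. Prescribing the digits
  $c_1, \ldots, c_n$ confines a point to a set of diameter about $\prod_i |c_i|^{-2}$, up to a factor
  that is only exponential in \<open>n\<close>. As the digits tend to infinity this factor is negligible, so
  covering by such cylinders is governed by the series $\sum_{c \in S} |c|^{-2s}$, whose critical
  exponent is $s = \tau/2$.

  \<^emph>\<open>Counting moduli or counting digits.\<close> The exponent is defined by the set of moduli, while the covers
  sum over the digits. The two agree because the number of Gaussian integers of modulus \<open>k\<close> is at most
  $C_\varepsilon k^\varepsilon$: for primitive points on a circle of squared radius \<open>m\<close> a divisor of
  \<open>m\<close> determines the point up to at most 15 choices, and the number of divisors of \<open>m\<close> is subpolynomial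
  (\<open>summable_gaussian_integers_if_summable_moduli\<close>).

  \<^emph>\<open>Upper bound.\<close> Let $\sum_{c \in S} |c|^{-2s}$ converge. The branch of the inverse of the Hurwitz
  map with digit \<open>c\<close> shrinks distances by the factor $\frac94 |c|^{-2}$ and also by the factor
  $\frac12$, so it changes a premeasure at scale \<open>d\<close> into one at scale \<open>d/2\<close> and multiplies it by at
  most $(\frac94)^s |c|^{-2s}$. If all digits come from a cofinite part of \<open>S\<close> over which these factors
  sum to at most $\frac12$, the set of such points is covered by its own images under these
  branches, and iterating shows that its premeasures vanish at all scales
  (\<open>hausdorff_measure_digits_in_null\<close>). Every point of \<open>hurwitz_F S\<close> has such digits from some
  index on, so \<open>hurwitz_F S\<close> lies in countably many images of a null set under contractions.

  \<^emph>\<open>Lower bound.\<close> Let $2s < \sigma < t < \tau$. Since $\sum k^{-t}$ diverges over the moduli, there are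
  finite blocks $B \subseteq S$ of arbitrarily large elements with $|B| \ge (\max_B |c|)^{\sigma}$.
  Any sequence of Gaussian integers of modulus at least 5 is the digit sequence of a point, and two
  points whose digits are bounded by \<open>M i\<close> and first differ at index \<open>n\<close> have distance at least
  $\prod_{i \le n} 1/(4 M_i^2)$ (\<open>cf_value_separation\<close>). A product of uniform measures on blocks then
  gives a cylinder of length \<open>n\<close> a mass that is smaller than the \<open>s\<close>-th power of the
  \<^emph>\<open>preceding\<close> gap $\prod_{i < n} 1/(4 M_i^2)$ by a factor of at least $2^n$. If one
  repeats each block often enough before passing to the next one, $2^n$ absorbs the one
  missing factor $(4 M_n^2)^s$, and the mass is at most a constant times the \<open>s\<close>-th power of the gap
  at level \<open>n\<close>. As a set of diameter below all gaps of levels less than \<open>n\<close> meets only one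
  cylinder of length \<open>n\<close>, no cover can have a small sum of powers of diameters
  (\<open>hausdorff_measure_product_coding_pos\<close>).
\<close>

section \<open>The number of Gaussian integers of a given modulus\<close>

lemma card_divisors_prime_power_mult_le:
  fixes p m :: nat
  assumes "prime p" "m > 0"
  shows "card {d. d dvd p ^ a * m} \<le> (a + 1) * card {d. d dvd m}"
proof -
  have "{d. d dvd p ^ a * m} \<subseteq> (\<lambda>(i, e). p ^ i * e) ` ({0..a} \<times> {d. d dvd m})"
  proof
    fix d assume "d \<in> {d. d dvd p ^ a * m}"
    then obtain b c where "d = b * c" "b dvd p ^ a" "c dvd m"
      using division_decomp by blast
    moreover obtain i where "i \<le> a" "b = p ^ i"
      using \<open>b dvd p ^ a\<close> assms(1) divides_primepow_nat by blast
    ultimately show "d \<in> (\<lambda>(i, e). p ^ i * e) ` ({0..a} \<times> {d. d dvd m})"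
      by force
  qed
  moreover have "finite ({0..a} \<times> {d. d dvd m})"
    using assms(2) by auto
  ultimately have "card {d. d dvd p ^ a * m} \<le> card ({0..a} \<times> {d. d dvd m})"
    by (meson surj_card_le)
  then show ?thesis by (simp add: card_cartesian_product)
qed

text \<open>The contribution of a small prime to the divisor bound: the exponential growth of the right-hand
side beats the linear left-hand side, by \<open>1 + x \<le> exp x\<close>.\<close>

lemma Suc_le_const_mult_two_powr:
  fixes e :: real
  assumes "e > 0"
  obtains K where "K \<ge> 1" "\<And>a::nat. real a + 1 \<le> K * 2 powr (e * real a)"
proof
  let ?K = "max 1 (1 / (e * ln 2))"
  show "?K \<ge> 1" by simp
  fix a :: nat
  have "1 + e * ln 2 * real a \<le> exp (e * ln 2 * real a)"
    by (rule exp_ge_add_one_self)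
  also have "\<dots> = 2 powr (e * real a)"
    by (simp add: powr_def algebra_simps)
  finally have *: "1 + e * ln 2 * real a \<le> 2 powr (e * real a)" .
  have "real a = (1 / (e * ln 2)) * (e * ln 2 * real a)"
    using assms by simp
  also have "\<dots> \<le> ?K * (e * ln 2 * real a)"
    using assms by (intro mult_right_mono) auto
  finally have "real a + 1 \<le> ?K * (e * ln 2 * real a) + ?K * 1" by linarith
  also have "\<dots> = ?K * (1 + e * ln 2 * real a)" by (simp add: algebra_simps)
  also have "\<dots> \<le> ?K * 2 powr (e * real a)"
    using * by (intro mult_left_mono) auto
  finally show "real a + 1 \<le> ?K * 2 powr (e * real a)" .
qed

text \<open>Split off the full power $p^a$ of one prime, which contributes a factor of at most \<open>a + 1\<close>. If
$p^e \ge 2$, then $a + 1 \le 2^a \le (p^a)^e$ and nothing is lost. Only the finitely many primes below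
$2^{1/e}$ cost a constant factor \<open>K\<close>, once each.\<close>

lemma divisor_bound:
  fixes e :: real
  assumes "e > 0"
  obtains C where "C > 0" "\<And>n::nat. n > 0 \<Longrightarrow> real (card {d. d dvd n}) \<le> C * real n powr e"
proof -
  obtain K where K: "K \<ge> 1" "\<And>a::nat. real a + 1 \<le> K * 2 powr (e * real a)"
    using Suc_le_const_mult_two_powr[OF assms] by blast
  define Q where "Q = nat \<lceil>2 powr (1 / e)\<rceil>"
  \<comment> \<open>the number of prime factors \<open>p\<close> of \<open>n\<close> with $p^e < 2$, up to rounding\<close>
  define w where "w n = card {p. prime p \<and> p dvd n \<and> p < Q}" for n :: nat
  have fin: "finite {p. prime p \<and> p dvd n \<and> p < Q}" for n :: nat
    by (rule finite_subset[of _ "{..<Q}"]) auto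
  have main: "real (card {d. d dvd n}) \<le> K ^ w n * real n powr e" if "n > 0" for n
    using that
  proof (induction n rule: less_induct)
    case (less n)
    show ?case
    proof (cases "n = 1")
      case True
      then show ?thesis using K(1) by simp
    next
      case False
      then obtain p where p: "prime p" "p dvd n"
        using less.prems prime_factor_nat by blast
      obtain a m where nm: "n = p ^ a * m" "\<not> p dvd m"
        using less.prems p(1) by (metis multiplicity_decompose' mult.commute not_prime_unit gr_implies_not_zero)
      have "a \<noteq> 0" using nm p(2) by (intro notI) simp
      have "m > 0" using nm less.prems by (cases m) auto
      have p2: "p \<ge> 2" using p(1) by (rule prime_ge_2_nat)
      have "p ^ a > 1" using one_less_power[of p a] \<open>a \<noteq> 0\<close> p2 by simp
      then have "m < n" using nm(1) \<open>m > 0\<close> by simp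
      have cop: "coprime p m" using p(1) nm(2) by (simp add: prime_imp_coprime)
      have pe: "real p powr (e * a) = (real p ^ a) powr e"
        using p2 by (simp add: powr_powr powr_realpow[symmetric] mult.commute)
      have step: "(real a + 1) * K ^ w m \<le> K ^ w n * real p powr (e * a)"
      proof (cases "p < Q")
        case True
        have "{q. prime q \<and> q dvd n \<and> q < Q} = insert p {q. prime q \<and> q dvd m \<and> q < Q}"
        proof -
          have "q dvd n \<longleftrightarrow> q = p \<or> q dvd m" if "prime q" for q
            using that p nm(1) \<open>a \<noteq> 0\<close>
            by (metis dvd_mult prime_dvd_mult_iff prime_dvd_power primes_dvd_imp_eq)
          then show ?thesis using True p(1) by auto
        qed
        then have "w n = Suc (w m)"
          unfolding w_def using nm(2) fin by simp
        moreover have "K * 2 powr (e * a) \<le> K * real p powr (e * a)"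
          using K(1) p2 assms by (intro mult_left_mono powr_mono2) auto
        ultimately show ?thesis using K(1) K(2)[of a]
          by (simp add: mult.assoc mult.left_commute)
            (smt (verit) K(1) mult.assoc mult.commute mult_left_mono zero_le_power)
      next
        case False
        then have "real p \<ge> 2 powr (1 / e)" unfolding Q_def by linarith
        then have "real p powr e \<ge> (2 powr (1 / e)) powr e"
          using assms by (intro powr_mono2) auto
        then have "2 \<le> real p powr e" using assms by (simp add: powr_powr)
        then have "2 ^ a \<le> (real p powr e) ^ a" by (intro power_mono) auto
        also have "\<dots> = real p powr (e * a)" using p2 by (simp add: powr_powr powr_realpow[symmetric])
        finally have "2 ^ a \<le> real p powr (e * a)" .
        moreover have "real a + 1 \<le> 2 ^ a"
        proof -
          have "a + 1 \<le> 2 ^ a" by (induction a) auto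
          then have "real (a + 1) \<le> real (2 ^ a)" by (rule of_nat_mono)
          then show ?thesis by simp
        qed
        moreover have "w m \<le> w n"
          unfolding w_def using fin nm by (intro card_mono) auto
        then have "K ^ w m \<le> K ^ w n" using K(1) by (intro power_increasing) auto
        ultimately show ?thesis using K(1)
          by (smt (verit) mult.commute mult_mono zero_le_power)
      qed
      have "real (card {d. d dvd n}) \<le> (real a + 1) * real (card {d. d dvd m})"
        using of_nat_mono[OF card_divisors_prime_power_mult_le[OF p(1) \<open>m > 0\<close>, of a], where 'a = real]
        unfolding nm(1) by (simp add: algebra_simps)
      also have "\<dots> \<le> (real a + 1) * (K ^ w m * real m powr e)"
        using less.IH[OF \<open>m < n\<close> \<open>m > 0\<close>] by (intro mult_left_mono) auto
      also have "\<dots> = ((real a + 1) * K ^ w m) * real m powr e" by simp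
      also have "\<dots> \<le> (K ^ w n * real p powr (e * a)) * real m powr e"
        using step by (intro mult_right_mono) auto
      also have "\<dots> = K ^ w n * real n powr e"
        unfolding pe nm(1) by (simp add: powr_mult)
      finally show ?thesis .
    qed
  qed
  show thesis
  proof
    show "K ^ Q > 0" using K(1) by simp
    fix n :: nat assume n: "n > 0"
    have "w n \<le> card {..<Q}" unfolding w_def by (intro card_mono) auto
    then have "K ^ w n \<le> K ^ Q" using K(1) by (intro power_increasing) auto
    then show "real (card {d. d dvd n}) \<le> K ^ Q * real n powr e"
      using main[OF n] by (smt (verit) mult_right_mono powr_ge_zero)
  qed
qed

definition circle_points :: "int \<Rightarrow> (int \<times> int) set" where
  "circle_points n = {(x, y). x\<^sup>2 + y\<^sup>2 = n}"

lemma abs_le_if_square_le: "\<bar>x::int\<bar> \<le> n" if "x\<^sup>2 \<le> n"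
proof (cases "x = 0")
  case False
  then have "\<bar>x\<bar> * 1 \<le> \<bar>x\<bar> * \<bar>x\<bar>" by (intro mult_left_mono) auto
  then show ?thesis using that by (simp add: power2_eq_square flip: abs_mult)
qed (use that in auto)

lemma finite_circle_points: "finite (circle_points n)"
proof (rule finite_subset)
  show "circle_points n \<subseteq> {- n..n} \<times> {- n..n}"
  proof
    fix z assume "z \<in> circle_points n"
    then obtain x y where z: "z = (x, y)" "x\<^sup>2 + y\<^sup>2 = n" by (auto simp: circle_points_def)
    have "x\<^sup>2 \<le> n" "y\<^sup>2 \<le> n" using z(2) zero_le_power2[of x] zero_le_power2[of y] by linarith+
    from this[THEN abs_le_if_square_le] show "z \<in> {- n..n} \<times> {- n..n}" using z(1) by auto
  qed
qed auto

definition primitive_circle_points :: "int \<Rightarrow> (int \<times> int) set" where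
  "primitive_circle_points n = {(x, y). x\<^sup>2 + y\<^sup>2 = n \<and> coprime x y}"

lemma primitive_circle_pointsD:
  assumes "(x, y) \<in> primitive_circle_points m"
  shows "x\<^sup>2 + y\<^sup>2 = m" "coprime x m" "coprime y m"
proof -
  show m: "x\<^sup>2 + y\<^sup>2 = m" using assms by (simp add: primitive_circle_points_def)
  have c: "coprime x y" using assms by (simp add: primitive_circle_points_def)
  have *: "coprime u (u\<^sup>2 + v\<^sup>2)" if "coprime u v" for u v :: int
    using that gcd_add_mult[of u u "v\<^sup>2"]
    by (simp add: coprime_iff_gcd_eq_1[symmetric] power2_eq_square)
  show "coprime x m" using *[OF c] m by simp
  show "coprime y m" using *[of y x] c m by (simp add: coprime_commute add.commute)
qed

text \<open>Cancelling the common factor of \<open>a\<close> and \<open>m\<close>.\<close>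

lemma dvd_quotient_by_gcd:
  fixes a b m :: int
  assumes "m dvd a * b" "m > 0"
  shows "m div gcd a m dvd b"
proof -
  let ?g = "gcd a m"
  have g: "?g > 0" using assms(2) by (simp add: gcd_pos_int)
  have "?g * (m div ?g) dvd ?g * ((a div ?g) * b)"
    using assms(1) by (simp add: mult.assoc[symmetric])
  then have "m div ?g dvd (a div ?g) * b" using g by (simp only: dvd_times_left_cancel_iff)
  moreover have "coprime (m div ?g) (a div ?g)"
    using div_gcd_coprime[of a m] assms(2) by (auto simp: coprime_commute)
  ultimately show ?thesis by (simp add: coprime_dvd_mult_right_iff)
qed

text \<open>For points \<open>(u, v)\<close> on the circle, $(u y_0 - x_0 v)(u y_0 + x_0 v)$ is divisible by \<open>m\<close>, so a divisor
$d_1$ of \<open>m\<close> divides the first factor and $d_2 = m/d_1$ the second. Two points with the same $d_1$ are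
proportional to each other modulo $d_1$ and modulo $d_2$. The factor 2 appears because $d_1$ and
$d_2$ may share a factor 2, but nothing more: a common divisor divides the sum $2 u y_0$ of the two
factors.\<close>

lemma dvd_twice_cross_product:
  fixes m :: int
  assumes m: "m > 0"
    and z0: "(x0, y0) \<in> primitive_circle_points m"
    and z: "(x, y) \<in> primitive_circle_points m"
    and z': "(x', y') \<in> primitive_circle_points m"
    and eq: "gcd (x * y0 - x0 * y) m = gcd (x' * y0 - x0 * y') m"
  shows "m dvd 2 * (x * y' - x' * y)"
proof -
  define d1 where "d1 = gcd (x * y0 - x0 * y) m"
  define d2 where "d2 = m div d1"
  define D where "D = x * y' - x' * y"
  have dd: "d1 * d2 = m" unfolding d1_def d2_def by simp
  have AB: "m dvd (u * y0 - x0 * v) * (u * y0 + x0 * v)"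
    if "(u, v) \<in> primitive_circle_points m" for u v
  proof -
    have "(u * y0 - x0 * v) * (u * y0 + x0 * v) = u\<^sup>2 * y0\<^sup>2 - x0\<^sup>2 * v\<^sup>2"
      by (simp add: power2_eq_square algebra_simps)
    also have "\<dots> = (m - v\<^sup>2) * y0\<^sup>2 - (m - y0\<^sup>2) * v\<^sup>2"
    proof -
      have "u\<^sup>2 = m - v\<^sup>2" "x0\<^sup>2 = m - y0\<^sup>2"
        using primitive_circle_pointsD(1)[OF that] primitive_circle_pointsD(1)[OF z0] by linarith+
      then show ?thesis by simp
    qed
    also have "\<dots> = m * (y0\<^sup>2 - v\<^sup>2)" by (simp add: algebra_simps)
    finally show ?thesis by simp
  qed
  have a: "d1 dvd x * y0 - x0 * y" "d1 dvd x' * y0 - x0 * y'"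
    unfolding d1_def by (simp, simp add: eq)
  have b: "d2 dvd x * y0 + x0 * y" "d2 dvd x' * y0 + x0 * y'"
    unfolding d1_def d2_def
     apply (rule dvd_quotient_by_gcd[OF AB[OF z] m])
    using dvd_quotient_by_gcd[OF AB[OF z'] m] by (simp add: eq)
  have cop1: "coprime y0 d1" "coprime y0 d2" "coprime x d1" "coprime x d2"
    using primitive_circle_pointsD(3)[OF z0] primitive_circle_pointsD(2)[OF z] unfolding dd[symmetric]
    by (auto)
  have "y0 * D = y' * (x * y0 - x0 * y) - y * (x' * y0 - x0 * y')"
    unfolding D_def by (simp add: algebra_simps)
  then have "d1 dvd y0 * D" using a by (metis dvd_diff dvd_mult)
  then have d1D: "d1 dvd D" using cop1 by (simp add: coprime_dvd_mult_right_iff coprime_commute)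
  have "y0 * D = y' * (x * y0 + x0 * y) - y * (x' * y0 + x0 * y')"
    unfolding D_def by (simp add: algebra_simps)
  then have "d2 dvd y0 * D" using b by (metis dvd_diff dvd_mult)
  then have d2D: "d2 dvd D" using cop1 by (simp add: coprime_dvd_mult_right_iff coprime_commute)
  let ?g = "gcd d1 d2"
  have "?g dvd (x * y0 - x0 * y) + (x * y0 + x0 * y)"
    using a b by (meson dvd_add dvd_trans gcd_dvd1 gcd_dvd2)
  then have "?g dvd (y0 * x) * 2" by (simp add: algebra_simps)
  moreover have "coprime ?g (y0 * x)"
    using cop1 by (metis coprime_commute coprime_mult_right_iff coprime_divisors dvd_refl gcd_dvd1)
  ultimately have g2: "?g dvd 2" by (simp add: coprime_dvd_mult_right_iff)
  have "lcm d1 d2 dvd D" using d1D d2D by simp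
  then have "?g * lcm d1 d2 dvd 2 * D" using g2 by (rule mult_dvd_mono[rotated])
  moreover have "m dvd ?g * lcm d1 d2"
    by (metis dd dvd_refl prod_gcd_lcm_int abs_dvd_iff abs_mult dvd_abs_iff)
  ultimately show ?thesis unfolding D_def by (meson dvd_trans)
qed

text \<open>Two points of the circle satisfy $D^2 + E^2 = m^2$ for their cross product \<open>D\<close> and inner product \<open>E\<close>,
and \<open>D\<close>, \<open>E\<close> determine the second point from the first. Among the points that share the divisor of
\<open>dvd_twice_cross_product\<close>, $2D/m$ is an integer between $-2$ and $2$, and the sign of \<open>E\<close> leaves 3
cases: 15 points at most.\<close>

lemma card_primitive_circle_points_le:
  assumes "m > 0"
  shows "card (primitive_circle_points (int m)) \<le> 15 * card {d. d dvd m}"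
proof (cases "primitive_circle_points (int m) = {}")
  case False
  then obtain x0 y0 where z0: "(x0, y0) \<in> primitive_circle_points (int m)" by auto
  let ?P = "primitive_circle_points (int m)"
  have finP: "finite ?P"
    by (rule finite_subset[OF _ finite_circle_points[of "int m"]])
      (auto simp: primitive_circle_points_def circle_points_def)
  define f where "f = (\<lambda>(x, y). nat (gcd (x * y0 - x0 * y) (int m)))"
  have fdiv: "f ` ?P \<subseteq> {d. d dvd m}"
  proof
    fix d assume "d \<in> f ` ?P"
    then obtain x y where "d = nat (gcd (x * y0 - x0 * y) (int m))" by (auto simp: f_def)
    moreover have "gcd (x * y0 - x0 * y) (int m) dvd int m" by simp
    ultimately show "d \<in> {d. d dvd m}" by (simp add: nat_dvd_iff)
  qed
  have fibre: "card {z \<in> ?P. f z = d} \<le> 15" for d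
  proof (cases "{z \<in> ?P. f z = d} = {}")
    case False
    then obtain x y where z: "(x, y) \<in> ?P" "f (x, y) = d" by auto
    have m: "x\<^sup>2 + y\<^sup>2 = int m" by (rule primitive_circle_pointsD(1)[OF z(1)])
    \<comment> \<open>cross product and inner product with the fixed point \<open>(x, y)\<close> of the fibre\<close>
    define D where "D = (\<lambda>(u, v). x * v - u * y)"
    define E where "E = (\<lambda>(u, v). x * u + y * v)"
    have DE: "(D w)\<^sup>2 + (E w)\<^sup>2 = (int m)\<^sup>2" if "w \<in> ?P" for w
    proof (cases w)
      case (Pair u v)
      have "(D w)\<^sup>2 + (E w)\<^sup>2 = (x\<^sup>2 + y\<^sup>2) * (u\<^sup>2 + v\<^sup>2)"
        unfolding D_def E_def Pair by (simp add: power2_eq_square algebra_simps)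
      then show ?thesis using m primitive_circle_pointsD(1) that Pair by (simp add: power2_eq_square)
    qed
    define g where "g w = (2 * D w div int m, sgn (E w))" for w
    have gD: "2 * D w = int m * fst (g w)" if "w \<in> ?P" "f w = d" for w
    proof -
      obtain u v where w: "w = (u, v)" by (cases w)
      have "nat (gcd (x * y0 - x0 * y) (int m)) = nat (gcd (u * y0 - x0 * v) (int m))"
        using that(2) z(2) unfolding w f_def by simp
      then have "gcd (x * y0 - x0 * y) (int m) = gcd (u * y0 - x0 * v) (int m)"
        by (subst (asm) eq_nat_nat_iff) auto
      then have "int m dvd 2 * (x * v - u * y)"
        using that(1) assms unfolding w
        by (intro dvd_twice_cross_product[OF _ z0 z(1)]) auto
      then show ?thesis unfolding g_def D_def w by simp
    qed
    have "g ` {z \<in> ?P. f z = d} \<subseteq> {-2..2} \<times> {-1..1}"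
    proof
      fix q assume "q \<in> g ` {z \<in> ?P. f z = d}"
      then obtain w where w: "w \<in> ?P" "f w = d" "q = g w" by auto
      have "(D w)\<^sup>2 \<le> (int m)\<^sup>2" using DE[OF w(1)] zero_le_power2[of "E w"] by linarith
      then have "\<bar>D w\<bar> \<le> int m" by (simp add: abs_le_square_iff[symmetric])
      then have "int m * \<bar>fst (g w)\<bar> \<le> int m * 2"
        using gD[OF w(1,2)] by (metis abs_mult abs_of_nat abs_numeral mult.commute mult_le_cancel_left_pos zero_less_numeral)
      then have "\<bar>fst (g w)\<bar> \<le> 2" using assms by simp
      then show "q \<in> {-2..2} \<times> {-1..1}"
        unfolding w(3) by (auto simp: g_def sgn_if)
    qed
    moreover have "inj_on g {z \<in> ?P. f z = d}"
    proof (rule inj_onI)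
      fix w w' assume w: "w \<in> {z \<in> ?P. f z = d}" and w': "w' \<in> {z \<in> ?P. f z = d}" and "g w = g w'"
      then have D: "D w = D w'" using gD[of w] gD[of w'] by simp
      have "(E w)\<^sup>2 = (E w')\<^sup>2" using DE[of w] DE[of w'] w w' D by simp
      moreover have "sgn (E w) = sgn (E w')" using \<open>g w = g w'\<close> by (simp add: g_def)
      ultimately have E: "E w = E w'"
        by (metis abs_sgn_eq power2_eq_iff sgn_minus mult_sgn_abs power2_eq_iff abs_minus)
      obtain u v u' v' where uv: "w = (u, v)" "w' = (u', v')" by (cases w, cases w') auto
      have "int m * u = x * E w - y * D w" "int m * v = y * E w + x * D w"
        "int m * u' = x * E w' - y * D w'" "int m * v' = y * E w' + x * D w'"
        unfolding D_def E_def uv m[symmetric] by (auto simp: power2_eq_square algebra_simps)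
      then have "int m * u = int m * u'" "int m * v = int m * v'" using D E by simp_all
      then show "w = w'" using assms uv by simp
    qed
    ultimately have "card {z \<in> ?P. f z = d} \<le> card ({-2..2::int} \<times> {-1..1::int})"
      by (intro card_inj_on_le) auto
    then show ?thesis by simp
  next
    case True
    then show ?thesis by (simp only: card.empty)
  qed
  have "card ?P = card (\<Union>d\<in>{d. d dvd m}. {z \<in> ?P. f z = d})"
    using fdiv by (intro arg_cong[where f = card]) auto
  also have "\<dots> \<le> (\<Sum>d\<in>{d. d dvd m}. card {z \<in> ?P. f z = d})"
    using assms by (intro card_UN_le) auto
  also have "\<dots> \<le> (\<Sum>d\<in>{d. d dvd m}. 15)" by (intro sum_mono fibre)
  finally show ?thesis by simp
qed simp

text \<open>Dividing by the gcd \<open>g\<close> of the coordinates gives a primitive point for $n/g^2$.\<close>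

lemma card_circle_points_le:
  assumes "n > 0"
  shows "card (circle_points (int n)) \<le> 15 * (card {d. d dvd n})\<^sup>2"
proof -
  let ?Q = "\<lambda>g. if g\<^sup>2 dvd n then primitive_circle_points (int (n div g\<^sup>2)) else {}"
  have finQ: "finite (?Q g)" for g
    by (rule finite_subset[OF _ finite_circle_points[of "int (n div g\<^sup>2)"]])
      (auto simp: primitive_circle_points_def circle_points_def split: if_splits)
  have "circle_points (int n) \<subseteq> (\<Union>g\<in>{d. d dvd n}. (\<lambda>(u, v). (int g * u, int g * v)) ` ?Q g)"
  proof
    fix z assume "z \<in> circle_points (int n)"
    then obtain x y where z: "z = (x, y)" "x\<^sup>2 + y\<^sup>2 = int n" by (auto simp: circle_points_def)
    define g where "g = nat (gcd x y)"
    have g: "int g = gcd x y" unfolding g_def by simp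
    have "gcd x y \<noteq> 0" using z(2) assms by auto
    then obtain u v where uv: "x = gcd x y * u" "y = gcd x y * v" "coprime u v"
      by (metis gcd_coprime_exists mult.commute)
    have n: "int n = int (g\<^sup>2) * (u\<^sup>2 + v\<^sup>2)"
      using z(2) uv(1,2) g by (metis distrib_left of_nat_power power_mult_distrib)
    have g2: "g\<^sup>2 dvd n" using n by (metis dvd_triv_left of_nat_dvd_iff)
    then have "g dvd n" by (metis dvd_mult_left power2_eq_square)
    have "int (n div g\<^sup>2) = u\<^sup>2 + v\<^sup>2"
      using n \<open>gcd x y \<noteq> 0\<close> g by (simp add: zdiv_int)
    then have "(u, v) \<in> ?Q g" using g2 uv(3) by (simp add: primitive_circle_points_def)
    moreover have "z = (\<lambda>(u, v). (int g * u, int g * v)) (u, v)" using z(1) uv g by simp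
    ultimately have "z \<in> (\<lambda>(u, v). (int g * u, int g * v)) ` ?Q g" by (rule rev_image_eqI)
    then show "z \<in> (\<Union>g\<in>{d. d dvd n}. (\<lambda>(u, v). (int g * u, int g * v)) ` ?Q g)"
      using \<open>g dvd n\<close> by blast
  qed
  then have "card (circle_points (int n)) \<le> card (\<Union>g\<in>{d. d dvd n}. (\<lambda>(u, v). (int g * u, int g * v)) ` ?Q g)"
    using finQ assms by (intro card_mono finite_UN_I finite_imageI) auto
  also have "\<dots> \<le> (\<Sum>g\<in>{d. d dvd n}. card ((\<lambda>(u, v). (int g * u, int g * v)) ` ?Q g))"
    using assms by (intro card_UN_le) auto
  also have "\<dots> \<le> (\<Sum>g\<in>{d. d dvd n}. card (?Q g))"
    by (intro sum_mono card_image_le finQ)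
  also have "\<dots> \<le> (\<Sum>g\<in>{d. d dvd n}. 15 * card {d. d dvd n})"
  proof (rule sum_mono)
    fix g assume "g \<in> {d. d dvd n}"
    show "card (?Q g) \<le> 15 * card {d. d dvd n}"
    proof (cases "g\<^sup>2 dvd n")
      case True
      have dvd_div_dvd: "n div g\<^sup>2 dvd n" using True by (metis dvd_div_mult_self dvd_triv_left)
      from True have pos: "n div g\<^sup>2 > 0" using assms by (metis dvd_div_eq_0_iff gr0I)
      have "{d. d dvd n div g\<^sup>2} \<subseteq> {d. d dvd n}" using True
        by (auto intro: dvd_trans[OF _ dvd_div_dvd])
      then have "card {d. d dvd n div g\<^sup>2} \<le> card {d. d dvd n}" using assms by (intro card_mono) auto
      then show ?thesis using card_primitive_circle_points_le[OF pos] True by simp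
    qed simp
  qed
  also have "\<dots> = 15 * (card {d. d dvd n})\<^sup>2" by (simp add: power2_eq_square)
  finally show ?thesis .
qed

lemma card_gaussian_integers_of_norm_le:
  fixes e :: real
  assumes "e > 0"
  shows "\<exists>C>0. \<forall>k>0. finite {c \<in> gaussian_integers. cmod c = k} \<and>
    real (card {c \<in> gaussian_integers. cmod c = k}) \<le> C * k powr e"
proof -
  obtain C where C: "C > 0" "\<And>n::nat. n > 0 \<Longrightarrow> real (card {d. d dvd n}) \<le> C * real n powr (e / 4)"
    using divisor_bound[of "e / 4"] assms by auto
  define h where "h = (\<lambda>(x::int, y::int). Complex (of_int x) (of_int y))"
  have sub: "\<exists>n. n > 0 \<and> k\<^sup>2 = real n \<and> {c \<in> gaussian_integers. cmod c = k} \<subseteq> h ` circle_points (int n)"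
    if ne: "{c \<in> gaussian_integers. cmod c = k} \<noteq> {}" and k: "k > 0" for k
  proof -
    have *: "\<exists>x y::int. c = Complex (of_int x) (of_int y) \<and> k\<^sup>2 = of_int (x\<^sup>2 + y\<^sup>2)"
      if c0: "c \<in> gaussian_integers" "cmod c = k" for c
    proof -
      obtain x y :: int where c: "c = Complex (of_int x) (of_int y)"
        using c0(1) unfolding gaussian_integers_def by (auto elim!: Ints_cases)
      moreover have "k\<^sup>2 = of_int (x\<^sup>2 + y\<^sup>2)"
        using c0(2) unfolding c by (auto simp: cmod_def)
      ultimately show ?thesis by blast
    qed
    obtain a b :: int where ab: "k\<^sup>2 = of_int (a\<^sup>2 + b\<^sup>2)" using ne * by blast
    define n where "n = nat (a\<^sup>2 + b\<^sup>2)"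
    have n: "int n = a\<^sup>2 + b\<^sup>2" unfolding n_def by simp
    then have kn: "k\<^sup>2 = real n" using ab by (metis of_int_of_nat_eq)
    show ?thesis
    proof (intro exI conjI)
      show "k\<^sup>2 = real n" by (rule kn)
      then show "n > 0" using k by (cases n) auto
      show "{c \<in> gaussian_integers. cmod c = k} \<subseteq> h ` circle_points (int n)"
      proof
        fix c assume "c \<in> {c \<in> gaussian_integers. cmod c = k}"
        then obtain x y :: int where c: "c = Complex (of_int x) (of_int y)" "k\<^sup>2 = of_int (x\<^sup>2 + y\<^sup>2)"
          using * by blast
        then have "x\<^sup>2 + y\<^sup>2 = int n" using kn by (metis of_int_eq_iff of_int_of_nat_eq)
        then have "(x, y) \<in> circle_points (int n)" by (simp add: circle_points_def)
        then show "c \<in> h ` circle_points (int n)" unfolding c(1) h_def by force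
      qed
    qed
  qed
  show ?thesis
  proof (intro exI[of _ "15 * C\<^sup>2"] conjI allI impI)
    show "15 * C\<^sup>2 > 0" using C(1) by simp
  next
    fix k :: real assume k: "k > 0"
    let ?A = "{c \<in> gaussian_integers. cmod c = k}"
    show "finite ?A"
      using sub[OF _ k] finite_circle_points by (cases "?A = {}") (auto intro: finite_subset)
  next
    fix k :: real assume k: "k > 0"
    let ?A = "{c \<in> gaussian_integers. cmod c = k}"
    show "real (card ?A) \<le> 15 * C\<^sup>2 * k powr e"
    proof (cases "?A = {}")
      case True
      then show ?thesis using C(1) by (simp only: card.empty) simp
    next
      case False
      then obtain n where n: "n > 0" "k\<^sup>2 = real n" "?A \<subseteq> h ` circle_points (int n)"
        using sub[OF _ k] by blast
      have "card ?A \<le> card (circle_points (int n))"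
        using n(3) finite_circle_points by (meson surj_card_le)
      also have "\<dots> \<le> 15 * (card {d. d dvd n})\<^sup>2" by (rule card_circle_points_le[OF n(1)])
      finally have "real (card ?A) \<le> real (15 * (card {d. d dvd n})\<^sup>2)" by (rule of_nat_mono)
      also have "\<dots> = 15 * (real (card {d. d dvd n}))\<^sup>2" by simp
      also have "\<dots> \<le> 15 * (C * real n powr (e / 4))\<^sup>2"
        using C(2)[OF n(1)] by (intro mult_left_mono power_mono) auto
      also have "(C * real n powr (e / 4))\<^sup>2 = C\<^sup>2 * k powr e"
        using k n(1) unfolding n(2)[symmetric]
        by (simp add: power_mult_distrib powr_powr powr_power flip: powr_numeral)
      finally show ?thesis by simp
    qed
  qed
qed

text \<open>Multiplicities of moduli cost only an arbitrarily small power, which the gap between \<open>t\<close> and \<open>u\<close>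
pays for.\<close>

lemma summable_gaussian_integers_if_summable_moduli:
  fixes t u :: real
  assumes S: "S \<subseteq> gaussian_integers"
    and sum: "(\<lambda>k. k powr (- t)) summable_on (cmod ` S - {0})"
    and "t < u"
  shows "(\<lambda>c. cmod c powr (- u)) summable_on (S - {0})"
proof -
  have "u - t > 0" using assms(3) by simp
  from card_gaussian_integers_of_norm_le[OF this] obtain C where C0: "C > 0"
    and C1: "\<forall>k>0. finite {c \<in> gaussian_integers. cmod c = k} \<and>
      real (card {c \<in> gaussian_integers. cmod c = k}) \<le> C * k powr (u - t)"
    by (elim exE conjE) (rule that)
  have C: "C > 0"
    "finite {c \<in> gaussian_integers. cmod c = k}"
    "real (card {c \<in> gaussian_integers. cmod c = k}) \<le> C * k powr (u - t)" if "k > 0" for k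
    using C0 C1[rule_format, OF that] by simp_all
  show ?thesis
  proof (rule nonneg_bdd_above_summable_on)
    show "bdd_above (sum (\<lambda>c. cmod c powr - u) ` {F. F \<subseteq> S - {0} \<and> finite F})"
    proof (rule bdd_aboveI2)
      fix F assume "F \<in> {F. F \<subseteq> S - {0} \<and> finite F}"
      then have F: "F \<subseteq> S - {0}" "finite F" by auto
      have "(\<Sum>c\<in>F. cmod c powr - u) = (\<Sum>k\<in>cmod ` F. \<Sum>c\<in>{c \<in> F. cmod c = k}. cmod c powr - u)"
        by (rule sum.image_gen[OF F(2)])
      also have "\<dots> \<le> (\<Sum>k\<in>cmod ` F. C * k powr (- t))"
      proof (rule sum_mono)
        fix k assume "k \<in> cmod ` F"
        then have k: "k > 0" using F(1) by auto
        have "(\<Sum>c\<in>{c \<in> F. cmod c = k}. cmod c powr - u) = real (card {c \<in> F. cmod c = k}) * k powr - u"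
          by simp
        also have "real (card {c \<in> F. cmod c = k}) \<le> real (card {c \<in> gaussian_integers. cmod c = k})"
          using F(1) S C(2)[OF k] by (intro of_nat_mono card_mono) auto
        also have "\<dots> \<le> C * k powr (u - t)" by (rule C(3)[OF k])
        also have "C * k powr (u - t) * k powr - u = C * k powr (- t)"
          using k by (simp flip: powr_add)
        finally show "(\<Sum>c\<in>{c \<in> F. cmod c = k}. cmod c powr - u) \<le> C * k powr (- t)"
          by (simp add: mult_right_mono)
      qed
      also have "\<dots> = C * (\<Sum>k\<in>cmod ` F. k powr (- t))" by (simp add: sum_distrib_left)
      also have "(\<Sum>k\<in>cmod ` F. k powr (- t)) \<le> infsum (\<lambda>k. k powr (- t)) (cmod ` S - {0})"
        using F by (intro finite_sum_le_infsum[OF sum]) auto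
      finally show "(\<Sum>c\<in>F. cmod c powr - u) \<le> C * infsum (\<lambda>k. k powr (- t)) (cmod ` S - {0})"
        using C0 by simp
    qed
  qed simp
qed

section \<open>Hausdorff premeasures and null sets\<close>

lemma diameter_le_if_dist_le:
  fixes X :: "'a::metric_space set"
  assumes "0 \<le> d" "\<And>x y. x \<in> X \<Longrightarrow> y \<in> X \<Longrightarrow> dist x y \<le> d"
  shows "diameter X \<le> d"
  using assms by (auto simp: diameter_def intro!: cSUP_least)

lemma hausdorff_premeasure_le:
  assumes "A \<subseteq> (\<Union>i. C i)" "\<And>i. bounded (C i)" "\<And>i. diameter (C i) \<le> d"
  shows "hausdorff_premeasure s d A \<le> (\<Sum>i. diam_power s (C i))"
  unfolding hausdorff_premeasure_def using assms by (intro INF_lower) auto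

lemma hausdorff_premeasure_mono:
  "A \<subseteq> B \<Longrightarrow> hausdorff_premeasure s d A \<le> hausdorff_premeasure s d B"
  unfolding hausdorff_premeasure_def by (rule INF_superset_mono) auto

lemma hausdorff_premeasure_antimono:
  "d \<le> d' \<Longrightarrow> hausdorff_premeasure s d' A \<le> hausdorff_premeasure s d A"
  unfolding hausdorff_premeasure_def by (rule INF_superset_mono) (auto intro: order_trans)

lemma hausdorff_premeasure_empty:
  assumes "0 \<le> d"
  shows "hausdorff_premeasure s d {} = 0"
proof -
  have "hausdorff_premeasure s d ({} :: 'a set) \<le> (\<Sum>i::nat. diam_power s ({} :: 'a set))"
    using assms by (intro hausdorff_premeasure_le) auto
  then show ?thesis by (simp add: diam_power_def)
qed

lemma hausdorff_premeasure_le_diam_power: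
  assumes "bounded A" "diameter A \<le> d"
  shows "hausdorff_premeasure s d A \<le> diam_power s A"
proof -
  let ?C = "\<lambda>i::nat. if i = 0 then A else {}"
  have d: "0 \<le> d" using diameter_ge_0[OF assms(1)] assms(2) by simp
  have "hausdorff_premeasure s d A \<le> (\<Sum>i. diam_power s (?C i))"
    using assms d by (intro hausdorff_premeasure_le) auto
  also have "\<dots> = (\<Sum>i\<in>{0}. diam_power s (?C i))"
    by (rule suminf_finite) (auto simp: diam_power_def)
  finally show ?thesis by simp
qed

lemma hausdorff_premeasure_countable_subadditive:
  "hausdorff_premeasure s d (\<Union>i::nat. A i) \<le> (\<Sum>i. hausdorff_premeasure s d (A i))"
proof (rule ennreal_le_epsilon)
  fix e :: real
  assume fin: "(\<Sum>i. hausdorff_premeasure s d (A i)) < top" and e: "0 < e"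
  have "\<exists>C. A i \<subseteq> (\<Union>j. C j) \<and> (\<forall>j. bounded (C j) \<and> diameter (C j) \<le> d) \<and>
      (\<Sum>j. diam_power s (C j)) < hausdorff_premeasure s d (A i) + ennreal (e * (1/2) ^ Suc i)" for i
  proof -
    have "hausdorff_premeasure s d (A i) \<noteq> \<infinity>"
      using ennreal_suminf_lessD[OF fin, of i] by auto
    from INF_approx_ennreal[OF _ hausdorff_premeasure_def this, of "e * (1/2) ^ Suc i"] e
    show ?thesis by auto
  qed
  then obtain C where C: "\<And>i. A i \<subseteq> (\<Union>j. C i j)" "\<And>i j. bounded (C i j)" "\<And>i j. diameter (C i j) \<le> d"
    "\<And>i. (\<Sum>j. diam_power s (C i j)) < hausdorff_premeasure s d (A i) + ennreal (e * (1/2) ^ Suc i)"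
    by metis
  let ?f = "\<lambda>(i, j). diam_power s (C i j)"
  have "hausdorff_premeasure s d (\<Union>i. A i) \<le> (\<Sum>n. diam_power s (case prod_decode n of (i, j) \<Rightarrow> C i j))"
  proof (rule hausdorff_premeasure_le)
    show "(\<Union>i. A i) \<subseteq> (\<Union>n. case prod_decode n of (i, j) \<Rightarrow> C i j)"
    proof
      fix x assume "x \<in> (\<Union>i. A i)"
      then obtain i j where "x \<in> C i j" using C(1) by blast
      then show "x \<in> (\<Union>n. case prod_decode n of (i, j) \<Rightarrow> C i j)"
        by (intro UN_I[of "prod_encode (i, j)"]) auto
    qed
  qed (use C in \<open>auto split: prod.split\<close>)
  also have "\<dots> = (\<Sum>n. ?f (prod_decode n))"
    by (intro suminf_cong) (auto split: prod.split)
  also have "\<dots> = (\<Sum>i. \<Sum>j. diam_power s (C i j))"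
    by (rule suminf_ennreal_2dimen) simp
  also have "\<dots> \<le> (\<Sum>i. hausdorff_premeasure s d (A i) + ennreal (e * (1/2) ^ Suc i))"
    using C(4) by (intro suminf_le) (auto intro: less_imp_le)
  also have "\<dots> = (\<Sum>i. hausdorff_premeasure s d (A i)) + (\<Sum>i. ennreal (e * (1/2) ^ Suc i))"
    by (rule suminf_add[symmetric]) auto
  also have "(\<Sum>i. ennreal (e * (1/2) ^ Suc i)) = ennreal e"
    using sums_mult[OF power_half_series, of e] e by (intro suminf_ennreal_eq) auto
  finally show "hausdorff_premeasure s d (\<Union>i. A i) \<le> (\<Sum>i. hausdorff_premeasure s d (A i)) + ennreal e" .
qed

text \<open>Pulling a cover of \<open>B\<close> back along \<open>g\<close> gives a cover of \<open>A\<close> whose diameters are smaller by the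
factor \<open>q\<close>. The scale \<open>d\<close> shrinks as well, which is what makes the estimate iterable.\<close>

lemma hausdorff_premeasure_expanding_le:
  fixes g :: "'a::metric_space \<Rightarrow> 'b::metric_space"
  assumes s: "s > 0" and q: "q > 0"
    and g: "g ` A \<subseteq> B"
    and dist: "\<And>x y. x \<in> A \<Longrightarrow> y \<in> A \<Longrightarrow> dist x y \<le> q * dist (g x) (g y)"
  shows "hausdorff_premeasure s (q * d) A \<le> ennreal (q powr s) * hausdorff_premeasure s d B"
proof -
  have *: "hausdorff_premeasure s (q * d) A \<le> ennreal (q powr s) * (\<Sum>i. diam_power s (C i))"
    if C: "B \<subseteq> (\<Union>i. C i)" "\<And>i. bounded (C i)" "\<And>i. diameter (C i) \<le> d" for C :: "nat \<Rightarrow> 'b set"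
  proof -
    define D where "D i = {x \<in> A. g x \<in> C i}" for i
    have Dd: "dist x y \<le> q * diameter (C i)" if "x \<in> D i" "y \<in> D i" for x y i
    proof -
      have "dist x y \<le> q * dist (g x) (g y)" using that by (intro dist) (auto simp: D_def)
      also have "\<dots> \<le> q * diameter (C i)"
        using that q C(2) by (intro mult_left_mono diameter_bounded_bound) (auto simp: D_def)
      finally show ?thesis .
    qed
    have bD: "bounded (D i)" for i
      using Dd[of _ i] unfolding bounded_def by (cases "D i = {}") blast+
    have dD: "diameter (D i) \<le> q * diameter (C i)" for i
      using Dd q diameter_ge_0[OF C(2)[of i]] by (intro diameter_le_if_dist_le) auto
    have "hausdorff_premeasure s (q * d) A \<le> (\<Sum>i. diam_power s (D i))"
    proof (rule hausdorff_premeasure_le[OF _ bD])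
      show "A \<subseteq> (\<Union>i. D i)" using g C(1) by (auto simp: D_def)
      show "diameter (D i) \<le> q * d" for i
        using dD[of i] C(3)[of i] q by (meson mult_left_mono less_imp_le order_trans)
    qed
    also have "\<dots> \<le> (\<Sum>i. ennreal (q powr s) * diam_power s (C i))"
    proof (intro suminf_le)
      fix i
      show "diam_power s (D i) \<le> ennreal (q powr s) * diam_power s (C i)"
      proof (cases "D i = {}")
        case True
        then show ?thesis by (simp add: diam_power_def)
      next
        case False
        then have ne: "C i \<noteq> {}" by (auto simp: D_def)
        have "diameter (D i) powr s \<le> (q * diameter (C i)) powr s"
          using dD[of i] s diameter_ge_0[OF bD[of i]] by (intro powr_mono2) auto
        also have "\<dots> = q powr s * diameter (C i) powr s"
          by (rule powr_mult)
        finally have "ennreal (diameter (D i) powr s) \<le> ennreal (q powr s * diameter (C i) powr s)"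
          by (rule ennreal_leI)
        then show ?thesis using False ne s by (simp add: diam_power_def ennreal_mult')
      qed
    qed auto
    finally show ?thesis by simp
  qed
  \<comment> \<open>A lower bound for the infimum over covers has to be free of the factor, so it is moved across by its inverse.\<close>
  define c where "c = ennreal (q powr s)"
  define c' where "c' = ennreal (1 / q powr s)"
  have cc: "c' * c = 1" "c * c' = 1"
    unfolding c_def c'_def using q by (simp_all flip: ennreal_mult')
  have "c' * hausdorff_premeasure s (q * d) A \<le> hausdorff_premeasure s d B"
    unfolding hausdorff_premeasure_def[of s d B]
  proof (rule INF_greatest)
    fix C :: "nat \<Rightarrow> 'b set"
    assume "C \<in> {C. B \<subseteq> (\<Union>i. C i) \<and> (\<forall>i. bounded (C i) \<and> diameter (C i) \<le> d)}"
    then have "hausdorff_premeasure s (q * d) A \<le> c * (\<Sum>i. diam_power s (C i))"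
      unfolding c_def by (intro *) auto
    then have "c' * hausdorff_premeasure s (q * d) A \<le> c' * (c * (\<Sum>i. diam_power s (C i)))"
      by (rule mult_left_mono) simp
    then show "c' * hausdorff_premeasure s (q * d) A \<le> (\<Sum>i. diam_power s (C i))"
      by (simp add: cc mult.assoc[symmetric])
  qed
  then have "c * (c' * hausdorff_premeasure s (q * d) A) \<le> c * hausdorff_premeasure s d B"
    by (rule mult_left_mono) simp
  then show ?thesis by (simp add: cc mult.assoc[symmetric] c_def[symmetric])
qed

lemma hausdorff_measure_eq_0_iff:
  "hausdorff_measure s A = 0 \<longleftrightarrow> (\<forall>d>0. hausdorff_premeasure s d A = 0)"
proof -
  have "hausdorff_measure s A \<le> 0 \<longleftrightarrow> (\<forall>d>0. hausdorff_premeasure s d A \<le> 0)"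
    unfolding hausdorff_measure_def SUP_le_iff by auto
  then show ?thesis by simp
qed

lemma hausdorff_measure_null_subset:
  "A \<subseteq> B \<Longrightarrow> hausdorff_measure s B = 0 \<Longrightarrow> hausdorff_measure s A = 0"
  using hausdorff_premeasure_mono[of A B s] by (auto simp: hausdorff_measure_eq_0_iff) (metis le_zero_eq)

lemma hausdorff_measure_null_UN:
  assumes "\<And>i::nat. hausdorff_measure s (A i) = 0"
  shows "hausdorff_measure s (\<Union>i. A i) = 0"
  unfolding hausdorff_measure_eq_0_iff
proof (intro allI impI)
  fix d :: real assume "d > 0"
  then have "hausdorff_premeasure s d (A i) = 0" for i
    using assms[of i] by (simp add: hausdorff_measure_eq_0_iff)
  then show "hausdorff_premeasure s d (\<Union>i. A i) = 0"
    using hausdorff_premeasure_countable_subadditive[of s d A] by simp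
qed

section \<open>Gaussian integers and the Hurwitz map\<close>

lemma gaussian_integers_iff: "z \<in> gaussian_integers \<longleftrightarrow> Re z \<in> \<int> \<and> Im z \<in> \<int>"
  unfolding gaussian_integers_def by (auto simp: complex_eq_iff)

lemma gaussian_field_iff: "z \<in> gaussian_field \<longleftrightarrow> Re z \<in> \<rat> \<and> Im z \<in> \<rat>"
  unfolding gaussian_field_def by (auto simp: complex_eq_iff)

lemma zero_in_gaussian_field: "0 \<in> gaussian_field"
  by (simp add: gaussian_field_iff)

lemma gaussian_integers_subset_field: "gaussian_integers \<subseteq> gaussian_field"
  by (auto simp: gaussian_integers_iff gaussian_field_iff elim!: Ints_cases)

lemma gaussian_field_inverse: "z \<in> gaussian_field \<Longrightarrow> 1 / z \<in> gaussian_field"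
  by (auto simp: gaussian_field_iff Re_divide Im_divide intro!: Rats_divide Rats_add Rats_power)

lemma gaussian_integers_diff: "a \<in> gaussian_integers \<Longrightarrow> b \<in> gaussian_integers \<Longrightarrow> a - b \<in> gaussian_integers"
  by (auto simp: gaussian_integers_iff)

lemma gaussian_integers_mult: "a \<in> gaussian_integers \<Longrightarrow> b \<in> gaussian_integers \<Longrightarrow> a * b \<in> gaussian_integers"
  by (auto simp: gaussian_integers_iff)

lemma gaussian_integers_norm_nat:
  assumes "a \<in> gaussian_integers"
  obtains n :: nat where "(cmod a)\<^sup>2 = real n"
proof -
  obtain x y :: int where xy: "Re a = of_int x" "Im a = of_int y"
    using assms by (auto simp: gaussian_integers_iff elim!: Ints_cases)
  have "(cmod a)\<^sup>2 = real (nat (x\<^sup>2 + y\<^sup>2))"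
    by (simp add: cmod_power2 xy)
  then show thesis by (rule that)
qed

lemma gaussian_integers_norm_ge_1:
  assumes "a \<in> gaussian_integers" "a \<noteq> 0"
  shows "1 \<le> cmod a"
proof -
  obtain n where n: "(cmod a)\<^sup>2 = real n" using gaussian_integers_norm_nat[OF assms(1)] .
  then have "n \<noteq> 0" using assms(2) by (intro notI) simp
  then have "1\<^sup>2 \<le> (cmod a)\<^sup>2" using n by simp
  then show ?thesis by (rule power2_le_imp_le) simp
qed

lemma finite_gaussian_integers_bounded: "finite {c \<in> gaussian_integers. cmod c \<le> k}"
proof (rule finite_subset)
  let ?I = "{- \<lceil>k\<rceil>..\<lceil>k\<rceil>}"
  show "{c \<in> gaussian_integers. cmod c \<le> k} \<subseteq> (\<lambda>(x, y). Complex (of_int x) (of_int y)) ` (?I \<times> ?I)"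
  proof
    fix c assume "c \<in> {c \<in> gaussian_integers. cmod c \<le> k}"
    then have c: "c \<in> gaussian_integers" "cmod c \<le> k" by auto
    obtain x y :: int where xy: "Re c = of_int x" "Im c = of_int y"
      using c(1) by (auto simp: gaussian_integers_iff elim!: Ints_cases)
    have "\<bar>of_int x\<bar> \<le> k" "\<bar>of_int y\<bar> \<le> k"
      using c(2) abs_Re_le_cmod[of c] abs_Im_le_cmod[of c] xy by linarith+
    then have "x \<in> ?I" "y \<in> ?I" by (simp_all add: abs_le_iff) linarith+
    moreover have "c = (\<lambda>(x, y). Complex (of_int x) (of_int y)) (x, y)"
      using xy by (simp add: complex_eq_iff)
    ultimately show "c \<in> (\<lambda>(x, y). Complex (of_int x) (of_int y)) ` (?I \<times> ?I)" by blast
  qed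
qed auto

lemma gauss_floor_in_gaussian_integers: "gauss_floor z \<in> gaussian_integers"
  unfolding gauss_floor_def gaussian_integers_def by auto

lemma hurwitz_map_in_square: "hurwitz_map z \<in> hurwitz_square"
  unfolding hurwitz_map_def hurwitz_square_def gauss_floor_def by simp linarith

lemma inverse_eq_digit_plus_map: "1 / z = gauss_floor (1 / z) + hurwitz_map z"
  unfolding hurwitz_map_def by simp

lemma hurwitz_square_norm_le: 
  assumes "z \<in> hurwitz_square"
  shows "(cmod z)\<^sup>2 \<le> 1/2"
proof -
  have "\<bar>Re z\<bar> \<le> 1/2" "\<bar>Im z\<bar> \<le> 1/2" using assms by (auto simp: hurwitz_square_def)
  then have "(Re z)\<^sup>2 \<le> (1/2)\<^sup>2" "(Im z)\<^sup>2 \<le> (1/2)\<^sup>2" by (simp_all add: abs_le_square_iff[symmetric])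
  then show ?thesis by (simp add: cmod_power2 power_divide)
qed

lemma hurwitz_square_bounded: "bounded hurwitz_square" "diameter hurwitz_square \<le> 2"
proof -
  have n: "cmod z \<le> 1" if "z \<in> hurwitz_square" for z
  proof -
    have "(cmod z)\<^sup>2 \<le> 1\<^sup>2" using hurwitz_square_norm_le[OF that] by simp
    then show ?thesis by (rule power2_le_imp_le) simp
  qed
  then show "bounded hurwitz_square" by (auto simp: bounded_iff)
  show "diameter hurwitz_square \<le> 2"
  proof (rule diameter_le_if_dist_le)
    fix x y assume "x \<in> hurwitz_square" "y \<in> hurwitz_square"
    then show "dist x y \<le> 2"
      using n[of x] n[of y] norm_triangle_ineq4[of x y] by (simp add: dist_norm)
  qed simp
qed

text \<open>For equal digits, $z - z' = z z' (H(z') - H(z))$. Points of the square have modulus at most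
$1/\sqrt 2$, which gives the factor $\frac12$. Moreover $z c = 1 - z H(z)$, so $|z| |c| \le \frac32$, which gives
the factor $\frac94 |c|^{-2}$ and excludes the digit 0.\<close>

lemma hurwitz_inverse_branch_contracts:
  assumes z: "z \<in> hurwitz_square" "z \<noteq> 0" "gauss_floor (1 / z) = c"
    and z': "z' \<in> hurwitz_square" "z' \<noteq> 0" "gauss_floor (1 / z') = c"
  shows "dist z z' \<le> 1/2 * dist (hurwitz_map z) (hurwitz_map z')"
    and "c \<noteq> 0"
    and "dist z z' \<le> (9/4) / (cmod c)\<^sup>2 * dist (hurwitz_map z) (hurwitz_map z')"
proof -
  have half: "cmod u * cmod v \<le> 1/2" if "u \<in> hurwitz_square" "v \<in> hurwitz_square" for u v
  proof -
    have "2 * (cmod u * cmod v) \<le> (cmod u)\<^sup>2 + (cmod v)\<^sup>2"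
      using sum_squares_bound[of "cmod u" "cmod v"] by simp
    then show ?thesis using that[THEN hurwitz_square_norm_le] by simp
  qed
  have "z - z' = z * z' * (hurwitz_map z' - hurwitz_map z)"
    using z z' unfolding hurwitz_map_def by (simp add: field_simps)
  then have d: "dist z z' = (cmod z * cmod z') * dist (hurwitz_map z) (hurwitz_map z')"
    by (simp add: dist_norm norm_mult norm_minus_commute)
  show "dist z z' \<le> 1/2 * dist (hurwitz_map z) (hurwitz_map z')"
    unfolding d using half[OF z(1) z'(1)] by (rule mult_right_mono) simp
  have c: "cmod u * cmod c \<le> 3/2" "c \<noteq> 0"
    if u: "u \<in> hurwitz_square" "u \<noteq> 0" "gauss_floor (1 / u) = c" for u
  proof -
    have "u * c = 1 - u * hurwitz_map u"
      using u unfolding hurwitz_map_def by (simp add: field_simps)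
    then have "cmod u * cmod c = cmod (1 - u * hurwitz_map u)" by (simp flip: norm_mult)
    also have "\<dots> \<le> 1 + cmod u * cmod (hurwitz_map u)"
      using norm_triangle_ineq4[of 1 "u * hurwitz_map u"] by (simp add: norm_mult)
    finally show "cmod u * cmod c \<le> 3/2"
      using half[OF u(1) hurwitz_map_in_square[of u]] by simp
    show "c \<noteq> 0"
    proof
      assume "c = 0"
      then have "u * hurwitz_map u = 1" using u unfolding hurwitz_map_def by simp
      then have "cmod u * cmod (hurwitz_map u) = 1" by (metis norm_mult norm_one)
      then show False using half[OF u(1) hurwitz_map_in_square[of u]] by simp
    qed
  qed
  show "c \<noteq> 0" using c(2)[OF z] .
  have "(cmod z * cmod c) * (cmod z' * cmod c) \<le> (3/2) * (3/2)"
    using c(1)[OF z] c(1)[OF z'] by (intro mult_mono) auto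
  then have "cmod z * cmod z' \<le> (9/4) / (cmod c)\<^sup>2"
    using \<open>c \<noteq> 0\<close> by (simp add: field_simps power2_eq_square)
  then show "dist z z' \<le> (9/4) / (cmod c)\<^sup>2 * dist (hurwitz_map z) (hurwitz_map z')"
    unfolding d by (rule mult_right_mono) simp
qed

lemma hurwitz_map_irrational:
  assumes "z \<notin> gaussian_field"
  shows "hurwitz_map z \<notin> gaussian_field"
proof
  assume "hurwitz_map z \<in> gaussian_field"
  then have "gauss_floor (1 / z) + hurwitz_map z \<in> gaussian_field"
    using gauss_floor_in_gaussian_integers[of "1 / z"] gaussian_integers_subset_field
    by (auto simp: gaussian_field_iff intro!: Rats_add)
  then have "1 / z \<in> gaussian_field" by (simp flip: inverse_eq_digit_plus_map)
  then have "1 / (1 / z) \<in> gaussian_field" by (rule gaussian_field_inverse)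
  then show False using assms by simp
qed

lemma hurwitz_digit_Suc_0: "hurwitz_digit (Suc 0) z = gauss_floor (1 / z)"
  by (simp add: hurwitz_digit_def)

lemma hurwitz_digit_Suc_Suc: "hurwitz_digit (Suc (Suc n)) z = hurwitz_digit (Suc n) (hurwitz_map z)"
  by (simp add: hurwitz_digit_def funpow_swap1)

text \<open>The Euclidean algorithm: for \<open>z = p / q\<close> the image under the Hurwitz map has denominator \<open>p\<close>, and
$|p|^2 \le \frac12 |q|^2$ since \<open>z\<close> lies in the square.\<close>

lemma hurwitz_terminates_quotient:
  assumes "z \<in> hurwitz_square" "p \<in> gaussian_integers" "q \<in> gaussian_integers"
    "q \<noteq> 0" "z = p / q" "(cmod q)\<^sup>2 = real N"
  shows "\<exists>n. (hurwitz_map ^^ n) z = 0"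
  using assms
proof (induction N arbitrary: z p q rule: less_induct)
  case (less N)
  show ?case
  proof (cases "z = 0")
    case True
    then show ?thesis by (intro exI[of _ 0]) simp
  next
    case False
    then have p: "p \<noteq> 0" using less.prems by auto
    obtain N' where N': "(cmod p)\<^sup>2 = real N'" using gaussian_integers_norm_nat[OF less.prems(2)] .
    have "(cmod p)\<^sup>2 = (cmod z)\<^sup>2 * (cmod q)\<^sup>2"
      using less.prems(4,5) by (simp add: norm_divide power_divide)
    also have "\<dots> \<le> 1/2 * (cmod q)\<^sup>2"
      by (intro mult_right_mono hurwitz_square_norm_le less.prems) simp
    also have "\<dots> < (cmod q)\<^sup>2" using less.prems(4) by simp
    finally have "N' < N" using N' less.prems(6) by simp
    moreover have "hurwitz_map z = (q - gauss_floor (1 / z) * p) / p"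
      using p less.prems(4,5) False unfolding hurwitz_map_def by (simp add: diff_divide_distrib)
    ultimately obtain n where "(hurwitz_map ^^ n) (hurwitz_map z) = 0"
      using less.IH[of N' "hurwitz_map z" "q - gauss_floor (1 / z) * p" p] hurwitz_map_in_square
        gaussian_integers_diff gaussian_integers_mult gauss_floor_in_gaussian_integers
        less.prems(2,3) p N' by blast
    then have "(hurwitz_map ^^ Suc n) z = 0" by (simp add: funpow_swap1)
    then show ?thesis by blast
  qed
qed

lemma hurwitz_terminates:
  assumes "z \<in> hurwitz_square" "z \<in> gaussian_field"
  shows "\<exists>n. (hurwitz_map ^^ n) z = 0"
proof -
  have "Re z \<in> \<rat>" "Im z \<in> \<rat>" using assms(2) by (auto simp: gaussian_field_iff)
  then obtain a b c d :: int where ab: "b > 0" "Re z = of_int a / of_int b"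
    and cd: "d > 0" "Im z = of_int c / of_int d"
    by (metis Rats_cases')
  \<comment> \<open>a common denominator for real and imaginary part\<close>
  let ?p = "Complex (of_int (a * d)) (of_int (c * b))" and ?q = "Complex (of_int (b * d)) 0"
  have q: "?q \<in> gaussian_integers" "?p \<in> gaussian_integers" by (auto simp: gaussian_integers_iff)
  obtain N where "(cmod ?q)\<^sup>2 = real N" using gaussian_integers_norm_nat[OF q(1)] .
  moreover have "?q \<noteq> 0" using ab cd by (simp add: complex_eq_iff)
  moreover have "z = ?p / ?q"
    using ab cd by (simp add: complex_eq_iff Re_divide Im_divide power2_eq_square)
  ultimately show ?thesis using hurwitz_terminates_quotient[OF assms(1) q(2,1)] by blast
qed

section \<open>The upper bound for the dimension\<close>

text \<open>The image of \<open>E\<close> under the branch with digit \<open>c\<close> of the inverse of the Hurwitz map, cut down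
to the square.\<close>

definition prepend_digit :: "complex \<Rightarrow> complex set \<Rightarrow> complex set" where
  "prepend_digit c E = {z \<in> hurwitz_square. z \<noteq> 0 \<and> gauss_floor (1 / z) = c \<and> hurwitz_map z \<in> E}"

lemma hausdorff_premeasure_prepend_digit_le:
  assumes s: "s > 0" and d: "d \<ge> 0"
  shows "hausdorff_premeasure s (d / 2) (prepend_digit c E)
    \<le> ennreal ((9/4) powr s * cmod c powr (- (2 * s))) * hausdorff_premeasure s d E"
proof (cases "prepend_digit c E = {}")
  case True
  then show ?thesis using d by (simp add: hausdorff_premeasure_empty)
next
  case False
  then have c: "c \<noteq> 0"
    using hurwitz_inverse_branch_contracts(2) unfolding prepend_digit_def by blast
  define q where "q = min (1/2) ((9/4) / (cmod c)\<^sup>2)"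
  have q: "q > 0" "q \<le> 1/2" using c by (auto simp: q_def)
  have "hausdorff_premeasure s (d / 2) (prepend_digit c E) \<le> hausdorff_premeasure s (q * d) (prepend_digit c E)"
    using mult_right_mono[OF q(2) d] by (intro hausdorff_premeasure_antimono) simp
  also have "\<dots> \<le> ennreal (q powr s) * hausdorff_premeasure s d E"
  proof (rule hausdorff_premeasure_expanding_le[OF s q(1)])
    show "hurwitz_map ` prepend_digit c E \<subseteq> E" by (auto simp: prepend_digit_def)
    fix x y assume "x \<in> prepend_digit c E" "y \<in> prepend_digit c E"
    then show "dist x y \<le> q * dist (hurwitz_map x) (hurwitz_map y)"
      using hurwitz_inverse_branch_contracts(1,3)[of x c y]
      by (auto simp: prepend_digit_def q_def min_def)
  qed
  also have "q powr s \<le> (9/4) powr s * cmod c powr (- (2 * s))"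
  proof -
    have "q powr s \<le> ((9/4) / (cmod c)\<^sup>2) powr s"
      using q s by (intro powr_mono2) (auto simp: q_def)
    also have "(9/4) / (cmod c)\<^sup>2 = (9/4) * cmod c powr (-2)"
      using c by (simp add: powr_minus_divide)
    also have "\<dots> powr s = (9/4) powr s * (cmod c powr (-2)) powr s"
      by (rule powr_mult)
    also have "\<dots> = (9/4) powr s * cmod c powr (- (2 * s))"
      by (simp add: powr_powr)
    finally show ?thesis .
  qed
  finally show ?thesis by (simp add: mult_right_mono ennreal_leI)
qed

lemma hausdorff_measure_prepend_digit_null:
  assumes "s > 0" "hausdorff_measure s E = 0"
  shows "hausdorff_measure s (prepend_digit c E) = 0"
  unfolding hausdorff_measure_eq_0_iff
proof (intro allI impI)
  fix d :: real assume "d > 0"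
  then show "hausdorff_premeasure s d (prepend_digit c E) = 0"
    using hausdorff_premeasure_prepend_digit_le[OF assms(1), of "2 * d" c E] assms(2)
    by (simp add: hausdorff_measure_eq_0_iff)
qed

lemma in_prepend_first_digit:
  assumes "z \<in> hurwitz_square - gaussian_field" "hurwitz_map z \<in> E"
  shows "z \<in> prepend_digit (hurwitz_digit (Suc 0) z) E"
  using assms zero_in_gaussian_field by (auto simp: prepend_digit_def hurwitz_digit_Suc_0)

definition digits_in :: "complex set \<Rightarrow> complex set" where
  "digits_in T = {z \<in> hurwitz_square - gaussian_field. \<forall>n. hurwitz_digit (Suc n) z \<in> T}"

text \<open>The set is covered by its own images under the branches with digits \<open>e i\<close>. By the assumption on the
sum, passing from scale \<open>d\<close> to \<open>d / 2\<close> at least halves the premeasure. But premeasures grow as the scale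
shrinks, and the one at scale 2 is finite, so all of them are 0.\<close>

lemma hausdorff_measure_digits_in_null:
  fixes e :: "nat \<Rightarrow> complex"
  assumes s: "s > 0" and sum: "summable (\<lambda>i. cmod (e i) powr (- (2 * s)))"
    and small: "(9/4) powr s * (\<Sum>i. cmod (e i) powr (- (2 * s))) \<le> 1/2"
  shows "hausdorff_measure s (digits_in (range e)) = 0"
  unfolding hausdorff_measure_eq_0_iff
proof (intro allI impI)
  let ?K = "digits_in (range e)"
  let ?h = "\<lambda>d. hausdorff_premeasure s d ?K"
  have sub: "?K \<subseteq> (\<Union>i. prepend_digit (e i) ?K)"
  proof
    fix z assume z: "z \<in> ?K"
    then have "hurwitz_map z \<in> ?K"
      using hurwitz_map_irrational hurwitz_map_in_square
      by (auto simp: digits_in_def simp flip: hurwitz_digit_Suc_Suc)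
    then have "z \<in> prepend_digit (hurwitz_digit (Suc 0) z) ?K"
      using z by (intro in_prepend_first_digit) (auto simp: digits_in_def)
    moreover have "hurwitz_digit (Suc 0) z \<in> range e" using z by (simp add: digits_in_def)
    ultimately show "z \<in> (\<Union>i. prepend_digit (e i) ?K)" by auto
  qed
  have step: "?h (d / 2) \<le> ennreal (1/2) * ?h d" if d: "d \<ge> 0" for d
  proof -
    have "?h (d / 2) \<le> hausdorff_premeasure s (d / 2) (\<Union>i. prepend_digit (e i) ?K)"
      by (rule hausdorff_premeasure_mono[OF sub])
    also have "\<dots> \<le> (\<Sum>i. hausdorff_premeasure s (d / 2) (prepend_digit (e i) ?K))"
      by (rule hausdorff_premeasure_countable_subadditive)
    also have "\<dots> \<le> (\<Sum>i. ennreal ((9/4) powr s * cmod (e i) powr (- (2 * s))) * ?h d)"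
      by (intro suminf_le hausdorff_premeasure_prepend_digit_le[OF s d]) auto
    also have "\<dots> = (\<Sum>i. ennreal ((9/4) powr s * cmod (e i) powr (- (2 * s)))) * ?h d"
      by simp
    also have "(\<Sum>i. ennreal ((9/4) powr s * cmod (e i) powr (- (2 * s))))
        = ennreal ((9/4) powr s * (\<Sum>i. cmod (e i) powr (- (2 * s))))"
      using sum by (subst suminf_ennreal2) (auto simp: suminf_mult summable_mult)
    also have "\<dots> * ?h d \<le> ennreal (1/2) * ?h d"
      using small by (intro mult_right_mono ennreal_leI) auto
    finally show ?thesis .
  qed
  have iter: "?h (2 / 2 ^ m) \<le> ennreal ((1/2) ^ m * 2 powr s)" for m
  proof (induction m)
    case 0
    have "?h 2 \<le> hausdorff_premeasure s 2 hurwitz_square"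
      by (intro hausdorff_premeasure_mono) (auto simp: digits_in_def)
    also have "\<dots> \<le> diam_power s hurwitz_square"
      by (intro hausdorff_premeasure_le_diam_power hurwitz_square_bounded)
    also have "\<dots> \<le> ennreal (2 powr s)"
      using s hurwitz_square_bounded
      by (auto simp: diam_power_def intro!: ennreal_leI powr_mono2 diameter_ge_0)
    finally show ?case by simp
  next
    case (Suc m)
    have "?h (2 / 2 ^ Suc m) = ?h ((2 / 2 ^ m) / 2)" by (simp add: field_simps)
    also have "\<dots> \<le> ennreal (1/2) * ?h (2 / 2 ^ m)" by (rule step) simp
    also have "\<dots> \<le> ennreal (1/2) * ennreal ((1/2) ^ m * 2 powr s)"
      by (rule mult_left_mono[OF Suc]) simp
    also have "\<dots> = ennreal (1/2 * ((1/2) ^ m * 2 powr s))"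
      by (rule ennreal_mult'[symmetric]) simp
    finally show ?case by (simp add: mult.assoc)
  qed
  fix d :: real assume d: "d > 0"
  obtain m0 where m0: "2 / 2 ^ m0 < d"
    using real_arch_pow_inv[of "d / 2" "1/2"] d by (auto simp: power_one_over field_simps)
  have "?h d \<le> ennreal e'" if e': "e' > 0" for e'
  proof -
    obtain m1 where m1: "(1/2) ^ m1 < e' / 2 powr s"
      using real_arch_pow_inv[of "e' / 2 powr s" "1/2"] e' by auto
    define m where "m = max m0 m1"
    have "2 / 2 ^ m \<le> 2 / (2::real) ^ m0"
      unfolding m_def by (intro divide_left_mono power_increasing) auto
    then have "2 / 2 ^ m \<le> d" using m0 by simp
    then have "?h d \<le> ?h (2 / 2 ^ m)" by (rule hausdorff_premeasure_antimono)
    also have "\<dots> \<le> ennreal ((1/2) ^ m * 2 powr s)" by (rule iter)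
    also have "(1/2) ^ m * 2 powr s \<le> (1/2) ^ m1 * 2 powr s"
      unfolding m_def by (intro mult_right_mono power_decreasing) auto
    also have "\<dots> \<le> e'" using m1 by (simp add: field_simps)
    finally show ?thesis by (simp add: ennreal_leI)
  qed
  then have "?h d \<le> 0"
    by - (rule ennreal_le_epsilon, simp)
  then show "?h d = 0" by simp
qed

text \<open>As the digits of a point of \<open>hurwitz_F S\<close> tend to infinity, from some index on they avoid any given
finite set. So it suffices to treat points whose digits after index \<open>M\<close> belong to a tail of an
enumeration of \<open>S\<close>, and these are obtained from the null set of points with all digits in
that tail by prepending \<open>M\<close> digits.\<close>

lemma hausdorff_dim_hurwitz_F_le:
  assumes S: "infinite S" "countable S"
    and s: "s > 0" and sum: "(\<lambda>c. cmod c powr (- (2 * s))) summable_on (S - {0})"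
  shows "hausdorff_dim (hurwitz_F S) \<le> ennreal s"
proof -
  define e where "e = from_nat_into S"
  have bij: "bij_betw e UNIV S"
    unfolding e_def by (rule bij_betw_from_nat_into[OF S(2,1)])
  then have ran: "range e = S" by (simp add: bij_betw_def)
  have "(\<lambda>c. cmod c powr (- (2 * s))) summable_on S"
    using sum by (subst summable_on_cong_neutral[where T = "S - {0}"]) auto
  then have "(\<lambda>i. cmod (e i) powr (- (2 * s))) summable_on UNIV"
    using summable_on_reindex_bij_betw[OF bij, of "\<lambda>c. cmod c powr (- (2 * s))"] by simp
  then have smb: "summable (\<lambda>i. cmod (e i) powr (- (2 * s)))"
    by (simp add: summable_on_UNIV_nonneg_real_iff)
  obtain N where N: "(\<Sum>i. cmod (e (i + N)) powr (- (2 * s))) < 1 / (2 * (9/4) powr s)"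
  proof -
    have "\<exists>N. \<forall>n\<ge>N. norm (\<Sum>i. cmod (e (i + n)) powr (- (2 * s))) < 1 / (2 * (9/4) powr s)"
      by (rule suminf_exist_split[OF _ smb]) simp
    then show thesis using that by (metis abs_less_iff le_refl real_norm_def)
  qed
  define T where "T = range (\<lambda>i. e (i + N))"
  define L where "L M = {z \<in> hurwitz_square - gaussian_field.
    (\<forall>n. hurwitz_digit (Suc n) z \<in> S) \<and> (\<forall>n\<ge>M. hurwitz_digit (Suc n) z \<in> T)}" for M
  have null: "hausdorff_measure s (L M) = 0" for M
  proof (induction M)
    case 0
    have "hausdorff_measure s (digits_in T) = 0"
      unfolding T_def
    proof (rule hausdorff_measure_digits_in_null[OF s])
      show "summable (\<lambda>i. cmod (e (i + N)) powr (- (2 * s)))"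
        using smb by (subst summable_iff_shift)
      show "(9/4) powr s * (\<Sum>i. cmod (e (i + N)) powr (- (2 * s))) \<le> 1/2"
        using N by (simp add: field_simps)
    qed
    then show ?case
      by (rule hausdorff_measure_null_subset[rotated]) (auto simp: L_def digits_in_def)
  next
    case (Suc M)
    have "L (Suc M) \<subseteq> (\<Union>i. prepend_digit (e i) (L M))"
    proof
      fix z assume z: "z \<in> L (Suc M)"
      have "hurwitz_map z \<in> L M"
        using z hurwitz_map_irrational hurwitz_map_in_square
        by (auto simp: L_def simp flip: hurwitz_digit_Suc_Suc)
      then have "z \<in> prepend_digit (hurwitz_digit (Suc 0) z) (L M)"
        using z by (intro in_prepend_first_digit) (auto simp: L_def)
      moreover have "hurwitz_digit (Suc 0) z \<in> range e" using z ran by (simp add: L_def)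
      ultimately show "z \<in> (\<Union>i. prepend_digit (e i) (L M))" by auto
    qed
    then show ?case
      by (rule hausdorff_measure_null_subset)
        (intro hausdorff_measure_null_UN hausdorff_measure_prepend_digit_null[OF s Suc])
  qed
  have "hurwitz_F S \<subseteq> (\<Union>M. L M)"
  proof
    fix z assume z: "z \<in> hurwitz_F S"
    define B where "B = Max (insert 0 ((\<lambda>i. cmod (e i)) ` {..<N}))"
    have "\<forall>\<^sub>F n in sequentially. B + 1 \<le> cmod (hurwitz_digit n z)"
      using z unfolding hurwitz_F_def filterlim_at_top by auto
    then obtain M where M: "\<And>n. n \<ge> M \<Longrightarrow> B + 1 \<le> cmod (hurwitz_digit n z)"
      unfolding eventually_sequentially by blast
    have dig: "hurwitz_digit (Suc n) z \<in> S" for n using z by (simp add: hurwitz_F_def)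
    have "hurwitz_digit (Suc n) z \<in> T" if "n \<ge> M" for n
    proof -
      obtain i where i: "hurwitz_digit (Suc n) z = e i" using dig[of n] ran by auto
      have "\<not> i < N"
      proof
        assume "i < N"
        then have "cmod (e i) \<le> B" unfolding B_def by (intro Max_ge) auto
        then show False using M[of "Suc n"] that i by simp
      qed
      then show ?thesis unfolding T_def i by (intro range_eqI[of _ _ "i - N"]) simp
    qed
    then have "z \<in> L M" using z dig by (auto simp: L_def hurwitz_F_def)
    then show "z \<in> (\<Union>M. L M)" by blast
  qed
  then have "hausdorff_measure s (hurwitz_F S) = 0"
    using hausdorff_measure_null_UN[OF null] by (rule hausdorff_measure_null_subset)
  then show ?thesis unfolding hausdorff_dim_def using s by (intro INF_lower) auto
qed

section \<open>Points with prescribed large digits\<close>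

text \<open>The recursion prepends a digit, so that induction moves along the shift of the digit sequence.\<close>

fun cf_convergent :: "nat \<Rightarrow> (nat \<Rightarrow> complex) \<Rightarrow> complex" where
  "cf_convergent 0 c = 0"
| "cf_convergent (Suc n) c = 1 / (c 0 + cf_convergent n (\<lambda>i. c (Suc i)))"

definition cf_value :: "(nat \<Rightarrow> complex) \<Rightarrow> complex" where
  "cf_value c = lim (\<lambda>n. cf_convergent n c)"

text \<open>With moduli at least 5, the disc of radius $\frac14$ is mapped into itself by each inverse branch
$w \mapsto 1/(a + w)$, with contraction factor $\frac1{16}$. This disc lies inside the square, hence no
restriction on consecutive digits arises.\<close>

lemma large_digit_add:
  assumes "5 \<le> cmod a" "cmod w \<le> 1/4"
  shows "4 \<le> cmod (a + w)" "a + w \<noteq> 0"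
proof -
  show "4 \<le> cmod (a + w)" using norm_diff_ineq[of a w] assms by linarith
  then show "a + w \<noteq> 0" by auto
qed

lemma diff_inverse_branches:
  assumes "5 \<le> cmod a" "cmod w \<le> 1/4" "5 \<le> cmod b" "cmod v \<le> 1/4"
  shows "dist (1 / (a + w)) (1 / (b + v)) = cmod ((b - a) + (v - w)) / (cmod (a + w) * cmod (b + v))"
proof -
  have "1 / (a + w) - 1 / (b + v) = ((b - a) + (v - w)) / ((a + w) * (b + v))"
    using large_digit_add(2)[OF assms(1,2)] large_digit_add(2)[OF assms(3,4)] by (simp add: field_simps)
  then show ?thesis by (simp add: dist_norm norm_divide norm_mult)
qed

lemma cf_convergent_small:
  assumes "\<And>i. 5 \<le> cmod (c i)"
  shows "cmod (cf_convergent n c) \<le> 1/4"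
  using assms
proof (induction n arbitrary: c)
  case (Suc n)
  have "4 \<le> cmod (c 0 + cf_convergent n (\<lambda>i. c (Suc i)))"
    by (intro large_digit_add Suc)
  then show ?case by (simp add: norm_divide divide_le_eq)
qed simp

lemma cf_convergent_diff:
  assumes "\<And>i. 5 \<le> cmod (c i)"
  shows "dist (cf_convergent (n + m) c) (cf_convergent n c) \<le> 1/4 * (1/16) ^ n"
  using assms
proof (induction n arbitrary: c)
  case 0
  then show ?case using cf_convergent_small[of c m] by simp
next
  case (Suc n)
  let ?c = "\<lambda>i. c (Suc i)"
  let ?w = "cf_convergent (n + m) ?c" and ?v = "cf_convergent n ?c"
  have s: "cmod ?w \<le> 1/4" "cmod ?v \<le> 1/4" by (intro cf_convergent_small Suc)+
  have "dist (cf_convergent (Suc n + m) c) (cf_convergent (Suc n) c)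
      = dist ?w ?v / (cmod (c 0 + ?w) * cmod (c 0 + ?v))"
    using diff_inverse_branches[OF Suc.prems s(1) Suc.prems s(2), of 0 0] by (simp add: dist_norm norm_minus_commute)
  also have "\<dots> \<le> dist ?w ?v / (4 * 4)"
    using large_digit_add(1)[OF Suc.prems s(1), of 0] large_digit_add(1)[OF Suc.prems s(2), of 0]
    by (intro divide_left_mono mult_mono mult_pos_pos) auto
  also have "\<dots> \<le> (1/4 * (1/16) ^ n) / 16"
    using Suc.IH[of ?c] Suc.prems by (simp add: divide_right_mono)
  finally show ?case by simp
qed

lemma cf_convergent_tendsto:
  assumes "\<And>i. 5 \<le> cmod (c i)"
  shows "(\<lambda>n. cf_convergent n c) \<longlonglongrightarrow> cf_value c"
proof -
  have "Cauchy (\<lambda>n. cf_convergent n c)"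
  proof (rule metric_CauchyI)
    fix e :: real assume "e > 0"
    then obtain N where N: "(1/16 :: real) ^ N < e" using real_arch_pow_inv[of e "1/16"] by auto
    have "dist (cf_convergent m c) (cf_convergent n c) < e" if "m \<ge> N" "n \<ge> N" for m n
    proof -
      have d: "dist (cf_convergent k c) (cf_convergent N c) \<le> 1/4 * (1/16) ^ N" if "k \<ge> N" for k
        using cf_convergent_diff[of c N "k - N"] assms that by simp
      have "dist (cf_convergent m c) (cf_convergent n c) \<le> 1/4 * (1/16) ^ N + 1/4 * (1/16) ^ N"
        using d[OF that(1)] d[OF that(2)] by (rule dist_triangle_le[OF order_trans[OF add_mono]]) (simp add: dist_commute)
      also have "\<dots> \<le> (1/16) ^ N" by simp
      finally show ?thesis using N by simp
    qed
    then show "\<exists>N. \<forall>m\<ge>N. \<forall>n\<ge>N. dist (cf_convergent m c) (cf_convergent n c) < e" by blast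
  qed
  then show ?thesis unfolding cf_value_def by (simp add: Cauchy_convergent_iff convergent_LIMSEQ_iff)
qed

lemma cf_value_small:
  assumes "\<And>i. 5 \<le> cmod (c i)"
  shows "cmod (cf_value c) \<le> 1/4"
  by (rule LIMSEQ_le_const2[OF tendsto_norm[OF cf_convergent_tendsto[of c]]])
    (use assms cf_convergent_small[of c] in auto)

lemma cf_value_unfold:
  assumes "\<And>i. 5 \<le> cmod (c i)"
  shows "cf_value c = 1 / (c 0 + cf_value (\<lambda>i. c (Suc i)))"
proof (rule LIMSEQ_unique)
  show "(\<lambda>n. cf_convergent (Suc n) c) \<longlonglongrightarrow> cf_value c"
    using cf_convergent_tendsto[OF assms] by (rule LIMSEQ_Suc)
  have "c 0 + cf_value (\<lambda>i. c (Suc i)) \<noteq> 0"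
    by (intro large_digit_add cf_value_small assms)
  then show "(\<lambda>n. cf_convergent (Suc n) c) \<longlonglongrightarrow> 1 / (c 0 + cf_value (\<lambda>i. c (Suc i)))"
    by (auto intro!: tendsto_intros cf_convergent_tendsto assms)
qed

text \<open>A remainder in the disc of radius $\frac14$ does not disturb rounding.\<close>

lemma gauss_floor_add_small:
  assumes "a \<in> gaussian_integers" "cmod w \<le> 1/4"
  shows "gauss_floor (a + w) = a"
proof -
  have "\<bar>Re w\<bar> \<le> 1/4" "\<bar>Im w\<bar> \<le> 1/4"
    using assms(2) abs_Re_le_cmod[of w] abs_Im_le_cmod[of w] by linarith+
  moreover obtain x y :: int where "Re a = of_int x" "Im a = of_int y"
    using assms(1) by (auto simp: gaussian_integers_iff elim!: Ints_cases)
  ultimately show ?thesis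
    unfolding gauss_floor_def by (simp add: complex_eq_iff) (auto simp: floor_eq_iff)
qed

lemma hurwitz_map_cf_value:
  assumes "\<And>i. 5 \<le> cmod (c i)" "\<And>i. c i \<in> gaussian_integers"
  shows "gauss_floor (1 / cf_value c) = c 0" "hurwitz_map (cf_value c) = cf_value (\<lambda>i. c (Suc i))"
proof -
  have *: "1 / cf_value c = c 0 + cf_value (\<lambda>i. c (Suc i))"
    by (subst cf_value_unfold[OF assms(1)]) simp
  show "gauss_floor (1 / cf_value c) = c 0"
    unfolding * by (intro gauss_floor_add_small cf_value_small assms)
  then show "hurwitz_map (cf_value c) = cf_value (\<lambda>i. c (Suc i))"
    unfolding hurwitz_map_def * by simp
qed

lemma hurwitz_map_funpow_cf_value:
  assumes "\<And>i. 5 \<le> cmod (c i)" "\<And>i. c i \<in> gaussian_integers"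
  shows "(hurwitz_map ^^ n) (cf_value c) = cf_value (\<lambda>i. c (n + i))"
proof (induction n)
  case (Suc n)
  then show ?case using hurwitz_map_cf_value(2)[of "\<lambda>i. c (n + i)"] assms by simp
qed simp

text \<open>The value is not in the Gaussian field because none of its iterates, which are again values of
such continued fractions, vanishes.\<close>

lemma cf_value_in_hurwitz_F:
  assumes large: "\<And>i. 5 \<le> cmod (c i)" and S: "\<And>i. c i \<in> S" "S \<subseteq> gaussian_integers"
    and lim: "filterlim (\<lambda>i. cmod (c i)) at_top sequentially"
  shows "cf_value c \<in> hurwitz_F S"
proof -
  have g: "c i \<in> gaussian_integers" for i using S by blast
  note iter = hurwitz_map_funpow_cf_value[of c, OF large g]
  have nz: "(hurwitz_map ^^ n) (cf_value c) \<noteq> 0" for n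
  proof -
    have "c n + cf_value (\<lambda>i. c (n + Suc i)) \<noteq> 0"
      by (intro large_digit_add cf_value_small large)
    then show ?thesis
      unfolding iter using large by (subst cf_value_unfold) auto
  qed
  have dig: "hurwitz_digit (Suc n) (cf_value c) = c n" for n
    unfolding hurwitz_digit_def using hurwitz_map_cf_value(1)[of "\<lambda>i. c (n + i)"] large g
    by (simp add: iter)
  have sq: "cf_value c \<in> hurwitz_square"
  proof -
    have "cmod (cf_value c) \<le> 1/4" by (intro cf_value_small large)
    then have "\<bar>Re (cf_value c)\<bar> \<le> 1/4" "\<bar>Im (cf_value c)\<bar> \<le> 1/4"
      using abs_Re_le_cmod[of "cf_value c"] abs_Im_le_cmod[of "cf_value c"] by linarith+
    then show ?thesis unfolding hurwitz_square_def by auto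
  qed
  moreover have "cf_value c \<notin> gaussian_field"
    using hurwitz_terminates[OF sq] nz by blast
  moreover have "hurwitz_digit n (cf_value c) \<in> S" if "n \<ge> 1" for n
    using that dig[of "n - 1"] S(1) by simp
  moreover have "filterlim (\<lambda>n. cmod (hurwitz_digit n (cf_value c))) at_top sequentially"
    using lim by (subst filterlim_sequentially_Suc[symmetric]) (simp add: dig)
  ultimately show ?thesis by (simp add: hurwitz_F_def)
qed

text \<open>The constant comes from $|a + w| \le m + \frac14 \le \frac{21}{20} m$ and $(21/20)^2 \le 2$.\<close>

lemma inverse_branches_dist_ge:
  assumes a: "5 \<le> cmod a" "cmod a \<le> m" and b: "5 \<le> cmod b" "cmod b \<le> m"
    and w: "cmod w \<le> 1/4" and v: "cmod v \<le> 1/4"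
  shows "cmod ((b - a) + (v - w)) / (2 * m\<^sup>2) \<le> dist (1 / (a + w)) (1 / (b + v))"
proof -
  have m: "5 \<le> m" using a by linarith
  have "cmod (a + w) \<le> 21/20 * m" "cmod (b + v) \<le> 21/20 * m"
    using norm_triangle_ineq[of a w] norm_triangle_ineq[of b v] a b w v m by linarith+
  then have "cmod (a + w) * cmod (b + v) \<le> (21/20 * m) * (21/20 * m)"
    using m by (intro mult_mono) auto
  also have "\<dots> \<le> 2 * m\<^sup>2" by (simp add: power2_eq_square)
  finally have "cmod (a + w) * cmod (b + v) \<le> 2 * m\<^sup>2" .
  moreover have "0 < cmod (a + w) * cmod (b + v)"
    using large_digit_add(2)[OF a(1) w] large_digit_add(2)[OF b(1) v] by simp
  ultimately show ?thesis
    unfolding diff_inverse_branches[OF a(1) w b(1) v]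
    using m by (intro divide_left_mono) auto
qed

text \<open>At the first index where the digits differ they do so by at least 1, and the remainders, of modulus at
most $\frac14$, can close at most half of this gap. Each earlier common digit multiplies distances
by at least $1/(2 M_i^2)$.\<close>

lemma cf_value_separation:
  assumes "\<And>i. 5 \<le> cmod (c i)" "\<And>i. c i \<in> gaussian_integers" "\<And>i. cmod (c i) \<le> M i"
    and "\<And>i. 5 \<le> cmod (c' i)" "\<And>i. c' i \<in> gaussian_integers" "\<And>i. cmod (c' i) \<le> M i"
    and "\<And>i. i < n \<Longrightarrow> c i = c' i" "c n \<noteq> c' n"
  shows "(\<Prod>i<Suc n. 1 / (4 * (M i)\<^sup>2)) \<le> dist (cf_value c) (cf_value c')"
  using assms
proof (induction n arbitrary: c c' M)
  case (0 c c' M)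
  let ?w = "cf_value (\<lambda>i. c (Suc i))" and ?v = "cf_value (\<lambda>i. c' (Suc i))"
  have w: "cmod ?w \<le> 1/4" "cmod ?v \<le> 1/4" by (intro cf_value_small 0)+
  have "1 \<le> cmod (c' 0 - c 0)"
    using 0 by (intro gaussian_integers_norm_ge_1 gaussian_integers_diff) auto
  then have "1/2 \<le> cmod ((c' 0 - c 0) + (?v - ?w))"
    using norm_diff_ineq[of "c' 0 - c 0" "?v - ?w"] norm_triangle_ineq4[of ?v ?w] w by linarith
  then have "(1/2) / (2 * (M 0)\<^sup>2) \<le> cmod ((c' 0 - c 0) + (?v - ?w)) / (2 * (M 0)\<^sup>2)"
    by (rule divide_right_mono) simp
  also have "\<dots> \<le> dist (1 / (c 0 + ?w)) (1 / (c' 0 + ?v))"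
    using w by (intro inverse_branches_dist_ge 0) auto
  also have "\<dots> = dist (cf_value c) (cf_value c')"
    using cf_value_unfold[of c] cf_value_unfold[of c'] 0 by simp
  finally show ?case by simp
next
  case (Suc n c c' M)
  let ?w = "cf_value (\<lambda>i. c (Suc i))" and ?v = "cf_value (\<lambda>i. c' (Suc i))"
  have w: "cmod ?w \<le> 1/4" "cmod ?v \<le> 1/4" by (intro cf_value_small Suc)+
  have eq: "c 0 = c' 0" by (rule Suc.prems) simp
  have IH: "(\<Prod>i<Suc n. 1 / (4 * (M (Suc i))\<^sup>2)) \<le> dist ?w ?v"
    using Suc.prems by (intro Suc.IH) auto
  have "(\<Prod>i<Suc (Suc n). 1 / (4 * (M i)\<^sup>2))
      = (\<Prod>i<Suc n. 1 / (4 * (M (Suc i))\<^sup>2)) / (4 * (M 0)\<^sup>2)"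
    by (subst prod.lessThan_Suc_shift) simp
  also have "\<dots> \<le> dist ?w ?v / (4 * (M 0)\<^sup>2)"
    using IH by (rule divide_right_mono) simp
  also have "\<dots> \<le> dist ?w ?v / (2 * (M 0)\<^sup>2)"
    using order_trans[OF Suc.prems(1) Suc.prems(3), of 0]
    by (intro divide_left_mono mult_pos_pos) auto
  also have "\<dots> = cmod ((c' 0 - c 0) + (?v - ?w)) / (2 * (M 0)\<^sup>2)"
    using eq by (simp add: dist_norm norm_minus_commute)
  also have "\<dots> \<le> dist (1 / (c 0 + ?w)) (1 / (c' 0 + ?v))"
    using w by (intro inverse_branches_dist_ge Suc.prems) auto
  also have "\<dots> = dist (cf_value c) (cf_value c')"
    using cf_value_unfold[of c] cf_value_unfold[of c'] Suc.prems by simp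
  finally show ?case .
qed

section \<open>Hausdorff measure of a coded product space\<close>

text \<open>A mass distribution principle for a set coded by sequences with \<open>c i \<in> B i\<close>, where \<open>G n\<close> is a lower bound
for the distance of points whose codes first differ at index \<open>n\<close>. The mass is the product of the
uniform measures. The codes of the points in a set \<open>X\<close> of diameter \<open>d\<close> agree up to the first \<open>n\<close>
with $G_n \le d$, so they lie in one cylinder, of mass at most $K G_n^s \le K d^s$. Thus the masses
of the cylinders belonging to a cover, which add up to at least 1, are bounded by \<open>K\<close> times its sum
of powers. Passing to cylinders also supplies the measurability that the set of codes of \<open>X\<close> may lack.\<close>

lemma hausdorff_measure_product_coding_pos:
  fixes f :: "(nat \<Rightarrow> 'b) \<Rightarrow> 'a::metric_space" and B :: "nat \<Rightarrow> 'b set" and G :: "nat \<Rightarrow> real"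
  assumes B: "\<And>i. finite (B i)" "\<And>i. B i \<noteq> {}"
    and sep: "\<And>c c' n. (\<And>i. c i \<in> B i) \<Longrightarrow> (\<And>i. c' i \<in> B i) \<Longrightarrow> (\<And>i. i < n \<Longrightarrow> c i = c' i) \<Longrightarrow>
      c n \<noteq> c' n \<Longrightarrow> G n \<le> dist (f c) (f c')"
    and G: "\<And>n. 0 < G n" "G \<longlonglongrightarrow> 0"
    and s: "0 \<le> s" and K: "0 < K"
    and mass: "\<And>n. (\<Prod>i<n. 1 / real (card (B i))) \<le> K * G n powr s"
    and E: "\<And>c. (\<And>i. c i \<in> B i) \<Longrightarrow> f c \<in> E"
  shows "hausdorff_measure s E \<noteq> 0"
proof
  assume null: "hausdorff_measure s E = 0"
  define U where "U i = uniform_count_measure (B i)" for i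
  interpret U: prob_space "U i" for i
    unfolding U_def using B by (rule prob_space_uniform_count_measure)
  interpret product_prob_space U UNIV by unfold_locales
  let ?P = "PiM UNIV U"
  have spU: "space (U i) = B i" "sets (U i) = Pow (B i)" for i
    by (simp_all add: U_def space_uniform_count_measure sets_uniform_count_measure)
  have spP: "c \<in> space ?P \<longleftrightarrow> (\<forall>i. c i \<in> B i)" for c
    by (auto simp: space_PiM spU)
  define Cyl where "Cyl c0 n = {c \<in> space ?P. \<forall>i\<in>{..<n}. c i \<in> {c0 i}}" for c0 n
  have Cyl_sets: "Cyl c0 n \<in> sets ?P" if "c0 \<in> space ?P" for c0 n
  proof -
    have "Cyl c0 n = prod_emb UNIV U {..<n} (\<Pi>\<^sub>E i\<in>{..<n}. {c0 i})"
      unfolding Cyl_def prod_emb_def by (auto simp: space_PiM Pi_iff)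
    also have "\<dots> \<in> sets ?P"
      using that spU spP by (intro sets_PiM_I) auto
    finally show ?thesis .
  qed
  have Cyl_mass: "emeasure ?P (Cyl c0 n) \<le> ennreal (K * G n powr s)" if "c0 \<in> space ?P" for c0 n
  proof -
    have "emeasure ?P (Cyl c0 n) = (\<Prod>i<n. emeasure (U i) {c0 i})"
      unfolding Cyl_def using that spU spP by (intro emeasure_PiM_Collect) auto
    also have "\<dots> = (\<Prod>i<n. ennreal (1 / real (card (B i))))"
      using that spP B unfolding U_def by (intro prod.cong refl) (simp add: emeasure_uniform_count_measure)
    also have "\<dots> = ennreal (\<Prod>i<n. 1 / real (card (B i)))" by (rule prod_ennreal) simp
    also have "\<dots> \<le> ennreal (K * G n powr s)" by (intro ennreal_leI mass)
    finally show ?thesis .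
  qed
  have cover: "\<exists>A\<in>sets ?P. {c \<in> space ?P. f c \<in> X} \<subseteq> A \<and> emeasure ?P A \<le> ennreal K * diam_power s X"
    if X: "bounded X" for X
  proof (cases "{c \<in> space ?P. f c \<in> X} = {}")
    case True
    then show ?thesis by (intro bexI[of _ "{}"]) auto
  next
    case False
    then obtain c0 where c0: "c0 \<in> space ?P" "f c0 \<in> X" by auto
    let ?d = "diameter X"
    have agree: "c \<in> Cyl c0 n" if "c \<in> space ?P" "f c \<in> X" "\<And>k. k < n \<Longrightarrow> ?d < G k" for c n
    proof (rule ccontr)
      assume "c \<notin> Cyl c0 n"
      then have ex: "\<exists>k. k < n \<and> c0 k \<noteq> c k" using that(1) by (auto simp: Cyl_def)
      define k where "k = (LEAST k. k < n \<and> c0 k \<noteq> c k)"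
      have k: "k < n" "c0 k \<noteq> c k" using LeastI_ex[OF ex] by (auto simp: k_def)
      have "c0 i = c i" if "i < k" for i
        using not_less_Least[of i "\<lambda>k. k < n \<and> c0 k \<noteq> c k"] that k(1) by (auto simp: k_def)
      then have "G k \<le> dist (f c0) (f c)"
        using c0 that(1) spP k by (intro sep) auto
      also have "\<dots> \<le> ?d" using X c0 that(2) by (intro diameter_bounded_bound) auto
      finally show False using that(3)[OF k(1)] by simp
    qed
    have d0: "0 \<le> ?d" using X by (rule diameter_ge_0)
    have ne: "X \<noteq> {}" using c0 by auto
    show ?thesis
    \<comment> \<open>A single point has one code only, and a single code has mass 0.\<close>
    proof (cases "?d = 0 \<and> s > 0")
      case True
      let ?A = "\<Inter>n. Cyl c0 n"
      have A: "?A \<in> sets ?P" using Cyl_sets[OF c0(1)] by (intro sets.countable_INT) auto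
      have "emeasure ?P ?A \<le> 0"
      proof (rule LIMSEQ_le_const)
        have "(\<lambda>n. K * G n powr s) \<longlonglongrightarrow> K * 0"
          using G True by (intro tendsto_mult tendsto_const tendsto_zero_powrI[of _ _ _ s])
            (auto simp: less_imp_le[OF G(1)])
        then show "(\<lambda>n. ennreal (K * G n powr s)) \<longlonglongrightarrow> 0"
          using tendsto_ennrealI by fastforce
        have "emeasure ?P ?A \<le> ennreal (K * G n powr s)" for n
          using emeasure_mono[of ?A "Cyl c0 n" ?P] Cyl_sets[OF c0(1)] Cyl_mass[OF c0(1), of n]
          by (meson INT_lower UNIV_I order_trans)
        then show "\<exists>N. \<forall>n\<ge>N. emeasure ?P ?A \<le> ennreal (K * G n powr s)" by blast
      qed
      moreover have "{c \<in> space ?P. f c \<in> X} \<subseteq> ?A"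
        using agree G(1) True by auto
      ultimately show ?thesis using A by (intro bexI[of _ ?A]) auto
    next
      case False
      have "\<exists>n. K * G n powr s \<le> K * (if s = 0 then 1 else ?d powr s) \<and> (\<forall>k<n. ?d < G k)"
      proof (cases "s = 0")
        case True
        \<comment> \<open>for exponent 0 each nonempty set counts 1, so the cylinder of length 0 is good enough\<close>
        then show ?thesis using G(1)[of 0] by (intro exI[of _ 0]) simp
      next
        case False
        then have dpos: "?d > 0" using \<open>\<not> (?d = 0 \<and> s > 0)\<close> s d0 by auto
        have "\<forall>\<^sub>F n in sequentially. G n < ?d" using G(2) dpos by (rule order_tendstoD(2))
        then have ex: "\<exists>n. G n \<le> ?d" by (auto simp: eventually_sequentially intro: less_imp_le)
        define n where "n = (LEAST n. G n \<le> ?d)"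
        have "G n \<le> ?d" using LeastI_ex[OF ex] by (simp add: n_def)
        moreover have "?d < G k" if "k < n" for k
          using not_less_Least[of k "\<lambda>n. G n \<le> ?d"] that by (auto simp: n_def)
        ultimately show ?thesis
          using False s K G(1)[of n] by (intro exI[of _ n]) (auto intro!: powr_mono2)
      qed
      then obtain n where n: "K * G n powr s \<le> K * (if s = 0 then 1 else ?d powr s)"
        "\<And>k. k < n \<Longrightarrow> ?d < G k" by blast
      have "emeasure ?P (Cyl c0 n) \<le> ennreal (K * (if s = 0 then 1 else ?d powr s))"
        using Cyl_mass[OF c0(1), of n] ennreal_leI[OF n(1)] by (rule order_trans)
      also have "\<dots> = ennreal K * diam_power s X"
        using ne K by (simp add: diam_power_def ennreal_mult')
      finally show ?thesis using agree[OF _ _ n(2)] Cyl_sets[OF c0(1)] by (intro bexI[of _ "Cyl c0 n"]) auto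
    qed
  qed
  have "hausdorff_premeasure s 1 E < ennreal (1 / K)"
    using null K by (simp add: hausdorff_measure_eq_0_iff)
  then obtain C :: "nat \<Rightarrow> 'a set" where C: "E \<subseteq> (\<Union>i. C i)" "\<And>i. bounded (C i)"
    "(\<Sum>i. diam_power s (C i)) < ennreal (1 / K)"
    unfolding hausdorff_premeasure_def INF_less_iff by auto
  have "\<forall>i. \<exists>A. A \<in> sets ?P \<and> {c \<in> space ?P. f c \<in> C i} \<subseteq> A \<and>
      emeasure ?P A \<le> ennreal K * diam_power s (C i)"
    using cover[OF C(2)] by (simp add: Bex_def)
  from choice[OF this] obtain A where
    "\<forall>i. A i \<in> sets ?P \<and> {c \<in> space ?P. f c \<in> C i} \<subseteq> A i \<and>
      emeasure ?P (A i) \<le> ennreal K * diam_power s (C i)" ..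
  then have A: "\<And>i. A i \<in> sets ?P" "\<And>i. {c \<in> space ?P. f c \<in> C i} \<subseteq> A i"
    "\<And>i. emeasure ?P (A i) \<le> ennreal K * diam_power s (C i)" by simp_all
  have "space ?P \<subseteq> (\<Union>i. A i)"
  proof
    fix c assume c: "c \<in> space ?P"
    then have "f c \<in> E" using spP by (intro E) auto
    then obtain i where "f c \<in> C i" using C(1) by auto
    then show "c \<in> (\<Union>i. A i)" using A(2)[of i] c by auto
  qed
  then have "emeasure ?P (space ?P) \<le> emeasure ?P (\<Union>i. A i)"
    using A(1) by (intro emeasure_mono) auto
  also have "\<dots> \<le> (\<Sum>i. emeasure ?P (A i))"
    using A(1) by (intro emeasure_subadditive_countably) auto
  also have "\<dots> \<le> (\<Sum>i. ennreal K * diam_power s (C i))"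
    using A(3) by (intro suminf_le) auto
  also have "\<dots> = ennreal K * (\<Sum>i. diam_power s (C i))" by simp
  also have "\<dots> < ennreal K * ennreal (1 / K)"
    using K C(3) by (intro ennreal_mult_strict_left_mono) auto
  also have "\<dots> = 1" using K by (simp flip: ennreal_mult')
  finally show False by (simp add: emeasure_space_1)
qed

section \<open>The lower bound for the dimension\<close>

text \<open>If no such block exists, then the modulus \<open>k\<close> of rank \<open>r k\<close> among those that are at least \<open>R\<close>
satisfies $r_k < k^\sigma$, because representatives of the moduli up to \<open>k\<close> would form a block. Hence
$k^{-t} \le r_k^{-t/\sigma}$, and the series converges because $t/\sigma > 1$ and ranks are distinct.\<close>

lemma large_blocks_if_not_summable:
  fixes S :: "complex set"
  assumes S: "S \<subseteq> gaussian_integers" and \<sigma>: "0 < \<sigma>" "\<sigma> < t"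
    and div: "\<not> (\<lambda>k. k powr (- t)) summable_on (cmod ` S - {0})"
  obtains B M where "finite B" "B \<subseteq> S" "B \<noteq> {}" "\<And>c. c \<in> B \<Longrightarrow> R \<le> cmod c"
    "\<And>c. c \<in> B \<Longrightarrow> cmod c \<le> M" "M powr \<sigma> \<le> real (card B)"
proof (rule ccontr)
  note block = that
  assume no: "\<not> thesis"
  define V where "V = {k \<in> cmod ` S. R \<le> k}"
  have finV: "finite {k \<in> cmod ` S. k \<le> m}" for m
    by (rule finite_subset[OF _ finite_imageI[OF finite_gaussian_integers_bounded[of m], of cmod]])
      (use S in auto)
  have finVm: "finite {j \<in> V. j \<le> k}" for k
    by (rule finite_subset[OF _ finV[of k]]) (auto simp: V_def)
  define r where "r k = card {j \<in> V. j \<le> k}" for k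
  have few: "real (r k) < k powr \<sigma>" if k: "k \<in> V" for k
  proof (rule ccontr)
    assume "\<not> real (r k) < k powr \<sigma>"
    let ?B = "inv_into S cmod ` {j \<in> V. j \<le> k}"
    have sub: "{j \<in> V. j \<le> k} \<subseteq> cmod ` S" by (auto simp: V_def)
    have B: "inv_into S cmod j \<in> S" "cmod (inv_into S cmod j) = j" if "j \<in> {j \<in> V. j \<le> k}" for j
      using sub that by (auto intro: inv_into_into f_inv_into_f simp: V_def)
    have "card ?B = r k"
      unfolding r_def by (intro card_image inj_on_inv_into sub)
    then have 1: "k powr \<sigma> \<le> real (card ?B)" using \<open>\<not> real (r k) < k powr \<sigma>\<close> by simp
    have 2: "finite ?B" "?B \<subseteq> S" "?B \<noteq> {}"
      using finVm[of k] B(1) k by auto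
    have 3: "R \<le> cmod c" "cmod c \<le> k" if "c \<in> ?B" for c
      using that B(2) by (auto simp: V_def)
    show False using no block[OF 2 3 1] by blast
  qed
  have inj: "inj_on r V"
  proof (rule linorder_inj_onI)
    fix x y assume xy: "x < y" "x \<in> V" "y \<in> V"
    then have "{j \<in> V. j \<le> x} \<subseteq> {j \<in> V. j \<le> y}"
      "y \<in> {j \<in> V. j \<le> y}" "y \<notin> {j \<in> V. j \<le> x}" by auto
    then have "{j \<in> V. j \<le> x} \<subset> {j \<in> V. j \<le> y}" by blast
    then have "r x < r y" unfolding r_def by (intro psubset_card_mono finVm)
    then show "r x \<noteq> r y" by simp
  qed auto
  have "summable (\<lambda>n. real n powr (- (t / \<sigma>)))"
    unfolding summable_real_powr_iff using \<sigma> by (simp add: field_simps)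
  then have "(\<lambda>n. real n powr (- (t / \<sigma>))) summable_on UNIV"
    by (simp add: summable_on_UNIV_nonneg_real_iff)
  then have "(\<lambda>n. real n powr (- (t / \<sigma>))) summable_on r ` V"
    by (rule summable_on_subset_banach) simp
  then have "(\<lambda>k. real (r k) powr (- (t / \<sigma>))) summable_on V"
    unfolding summable_on_reindex[OF inj] by (simp add: o_def)
  then have sV: "(\<lambda>k. k powr (- t)) summable_on V"
  proof (rule summable_on_comparison_test)
    fix k assume k: "k \<in> V"
    have "k \<in> {j \<in> V. j \<le> k}" using k by simp
    then have rpos: "r k > 0" unfolding r_def using finVm[of k] card_gt_0_iff by blast
    have "k powr (- t) = (k powr \<sigma>) powr (- (t / \<sigma>))"
      using \<sigma> by (simp add: powr_powr)
    also have "\<dots> \<le> real (r k) powr (- (t / \<sigma>))"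
      using few[OF k] rpos \<sigma> by (intro powr_mono2') auto
    finally show "k powr (- t) \<le> real (r k) powr (- (t / \<sigma>))" .
  qed simp
  have "(\<lambda>k. k powr (- t)) summable_on {k \<in> cmod ` S. k < R}"
    by (rule summable_on_finite, rule finite_subset[OF _ finV[of R]]) auto
  then have "(\<lambda>k. k powr (- t)) summable_on ({k \<in> cmod ` S. k < R} \<union> V)"
    using sV by (rule summable_on_Un_disjoint) (auto simp: V_def)
  then have "(\<lambda>k. k powr (- t)) summable_on (cmod ` S - {0})"
    by (rule summable_on_subset_banach) (auto simp: V_def)
  then show False using div by simp
qed

text \<open>A sequence of indices that tends to infinity, but waits at each index until $2^n$ has caught up with
the cost \<open>L\<close> of the next one, up to the constant \<open>L 0\<close>.\<close>

lemma slow_schedule: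
  fixes L :: "nat \<Rightarrow> real"
  assumes "L 0 > 0"
  obtains \<kappa> :: "nat \<Rightarrow> nat" where "filterlim \<kappa> at_top sequentially" "\<And>n. L (\<kappa> n) \<le> L 0 * 2 ^ n"
proof -
  define \<kappa> where "\<kappa> n = Max {k. k \<le> n \<and> L k \<le> L 0 * 2 ^ n}" for n
  have fin: "finite {k. k \<le> n \<and> L k \<le> L 0 * 2 ^ n}" for n by simp
  have "L 0 \<le> L 0 * 2 ^ n" for n using assms by simp
  then have "0 \<in> {k. k \<le> n \<and> L k \<le> L 0 * 2 ^ n}" for n by simp
  then have "\<kappa> n \<in> {k. k \<le> n \<and> L k \<le> L 0 * 2 ^ n}" for n
    unfolding \<kappa>_def by (intro Max_in fin) blast
  then have 1: "L (\<kappa> n) \<le> L 0 * 2 ^ n" for n by simp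
  have 2: "filterlim \<kappa> at_top sequentially"
    unfolding filterlim_at_top
  proof
    fix K :: nat
    obtain m where m: "L K / L 0 < 2 ^ m" using real_arch_pow[of 2 "L K / L 0"] by auto
    have "K \<le> \<kappa> n" if n: "n \<ge> max K m" for n
    proof -
      have "L K \<le> L 0 * 2 ^ m" using m assms by (simp add: field_simps)
      also have "\<dots> \<le> L 0 * 2 ^ n" using n assms by (intro mult_left_mono power_increasing) auto
      finally show ?thesis unfolding \<kappa>_def using n by (intro Max_ge fin) simp
    qed
    then show "\<forall>\<^sub>F n in sequentially. K \<le> \<kappa> n" unfolding eventually_sequentially by blast
  qed
  show thesis by (rule that[OF 2 1])
qed

text \<open>Blocks are taken so large that $|D_k| \ge 2 (4 N_k^2)^s$, where \<open>N k\<close> bounds the moduli in the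
block: this is possible since $|D_k| \ge N_k^\sigma$ with $\sigma > 2s$. The surplus factor 2 of each
of the first \<open>n\<close> blocks pays for the factor $(4 N^2)^s$ of the block at index \<open>n\<close>, which enters the
gap \<open>G n\<close> but not the mass of a cylinder of length \<open>n\<close>.\<close>

lemma hausdorff_measure_hurwitz_F_pos:
  fixes S :: "complex set"
  assumes S: "S \<subseteq> gaussian_integers" and s: "0 \<le> s" "2 * s < t"
    and div: "\<not> (\<lambda>k. k powr (- t)) summable_on (cmod ` S - {0})"
  shows "hausdorff_measure s (hurwitz_F S) \<noteq> 0"
proof -
  define \<sigma> where "\<sigma> = (2 * s + t) / 2"
  have \<sigma>: "0 < \<sigma>" "\<sigma> < t" "2 * s < \<sigma>" using s by (auto simp: \<sigma>_def)
  define \<eta> where "\<eta> = \<sigma> - 2 * s"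
  have \<eta>: "\<eta> > 0" using \<sigma> by (simp add: \<eta>_def)
  \<comment> \<open>5 makes digits codable, \<open>k\<close> forces them to infinity, and the last term gives $N^\eta \ge 2 \cdot 4^s$\<close>
  define R where "R k = max (max 5 (real k)) ((2 * 4 powr s) powr (1 / \<eta>))" for k :: nat
  have "\<exists>B M. finite B \<and> B \<subseteq> S \<and> B \<noteq> {} \<and> (\<forall>c\<in>B. R k \<le> cmod c \<and> cmod c \<le> M) \<and>
      M powr \<sigma> \<le> real (card B)" for k
  proof -
    obtain B M where "finite B" "B \<subseteq> S" "B \<noteq> {}" "\<And>c. c \<in> B \<Longrightarrow> R k \<le> cmod c"
      "\<And>c. c \<in> B \<Longrightarrow> cmod c \<le> M" "M powr \<sigma> \<le> real (card B)"
      using large_blocks_if_not_summable[OF S \<sigma>(1,2) div, of "R k"] by blast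
    then show ?thesis by (intro exI[of _ B] exI[of _ M]) auto
  qed
  then have "\<forall>k. \<exists>p. finite (fst p) \<and> fst p \<subseteq> S \<and> fst p \<noteq> {} \<and>
      (\<forall>c\<in>fst p. R k \<le> cmod c \<and> cmod c \<le> snd p) \<and> snd p powr \<sigma> \<le> real (card (fst p))"
    by simp
  from choice[OF this] obtain p where p: "\<forall>k. finite (fst (p k)) \<and> fst (p k) \<subseteq> S \<and> fst (p k) \<noteq> {} \<and>
      (\<forall>c\<in>fst (p k). R k \<le> cmod c \<and> cmod c \<le> snd (p k)) \<and> snd (p k) powr \<sigma> \<le> real (card (fst (p k)))" ..
  define D where "D k = fst (p k)" for k
  define N where "N k = snd (p k)" for k
  have D: "finite (D k)" "D k \<subseteq> S" "D k \<noteq> {}" "\<And>c. c \<in> D k \<Longrightarrow> R k \<le> cmod c"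
    "\<And>c. c \<in> D k \<Longrightarrow> cmod c \<le> N k" "N k powr \<sigma> \<le> real (card (D k))" for k
    using p[rule_format, of k] by (simp_all add: D_def N_def)
  have NR: "R k \<le> N k" for k
  proof -
    obtain c where "c \<in> D k" using D(3)[of k] by blast
    then show ?thesis using D(4)[of c k] D(5)[of c k] by linarith
  qed
  have N5: "5 \<le> N k" for k using NR[of k] by (simp add: R_def)
  have big: "2 * (4 * (N k)\<^sup>2) powr s \<le> real (card (D k))" for k
  proof -
    have "2 * 4 powr s = ((2 * 4 powr s) powr (1 / \<eta>)) powr \<eta>"
      using \<eta> by (simp add: powr_powr)
    also have "\<dots> \<le> N k powr \<eta>"
      using NR[of k] \<eta> by (intro powr_mono2) (auto simp: R_def)
    finally have "(2 * 4 powr s) * N k powr (2 * s) \<le> N k powr \<eta> * N k powr (2 * s)"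
      by (rule mult_right_mono) simp
    also have "\<dots> = N k powr \<sigma>" by (simp add: \<eta>_def flip: powr_add)
    also have "\<dots> \<le> real (card (D k))" by (rule D)
    also have "(2 * 4 powr s) * N k powr (2 * s) = 2 * (4 * (N k)\<^sup>2) powr s"
      using N5[of k] by (simp add: powr_mult powr_powr flip: powr_numeral)
    finally show ?thesis .
  qed
  define L where "L k = (4 * (N k)\<^sup>2) powr s" for k
  have Lpos: "L k > 0" for k using N5[of k] by (simp add: L_def)
  obtain \<kappa> where \<kappa>: "filterlim \<kappa> at_top sequentially" "\<And>n. L (\<kappa> n) \<le> L 0 * 2 ^ n"
    using slow_schedule[of L, OF Lpos] by blast
  define G where "G n = (\<Prod>i<Suc n. 1 / (4 * (N (\<kappa> i))\<^sup>2))" for n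
  have Gpos: "0 < G n" for n
    unfolding G_def using N5 by (intro prod_pos) (metis divide_pos_pos mult_pos_pos not_numeral_le_zero zero_less_numeral zero_less_one zero_less_power2)
  show ?thesis
  proof (rule hausdorff_measure_product_coding_pos[where f = cf_value and B = "\<lambda>i. D (\<kappa> i)" and G = G and K = "L 0"])
    show "finite (D (\<kappa> i))" "D (\<kappa> i) \<noteq> {}" for i by (rule D)+
    show "0 < G n" for n by (rule Gpos)
    show "0 \<le> s" "0 < L 0" by (rule s Lpos)+
  next
    fix c c' :: "nat \<Rightarrow> complex" and n
    assume c: "\<And>i. c i \<in> D (\<kappa> i)" "\<And>i. c' i \<in> D (\<kappa> i)" "\<And>i. i < n \<Longrightarrow> c i = c' i" "c n \<noteq> c' n"
    have *: "5 \<le> cmod a \<and> a \<in> gaussian_integers \<and> cmod a \<le> N k" if "a \<in> D k" for a k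
      using D(2)[of k] D(4,5)[of a k] that S by (auto simp: R_def)
    show "G n \<le> dist (cf_value c) (cf_value c')"
      unfolding G_def using *[OF c(1)] *[OF c(2)] c(3,4) by (intro cf_value_separation) auto
  next
    have "G n \<le> (1/2) ^ Suc n" for n
    proof -
      have "1 / (4 * (N k)\<^sup>2) \<le> 1/2" for k
      proof -
        have "5\<^sup>2 \<le> (N k)\<^sup>2" using N5[of k] by (intro power_mono) auto
        then show ?thesis by (simp add: divide_le_eq)
      qed
      then have "G n \<le> (\<Prod>i<Suc n. 1/2)" unfolding G_def by (intro prod_mono) auto
      then show ?thesis by simp
    qed
    moreover have "(\<lambda>n. (1/2 :: real) ^ Suc n) \<longlonglongrightarrow> 0"
      by (intro LIMSEQ_Suc LIMSEQ_power_zero) simp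
    ultimately show "G \<longlonglongrightarrow> 0"
      by (intro tendsto_sandwich[where f = "\<lambda>_. 0" and g = G and h = "\<lambda>n. (1/2) ^ Suc n", OF _ _ tendsto_const]
          always_eventually allI less_imp_le[OF Gpos]) auto
  next
    fix n
    have "(\<Prod>i<n. 1 / real (card (D (\<kappa> i)))) \<le> (\<Prod>i<n. (1/2) * (1 / L (\<kappa> i)))"
    proof (intro prod_mono conjI)
      fix i
      show "1 / real (card (D (\<kappa> i))) \<le> (1/2) * (1 / L (\<kappa> i))"
      proof -
        have "2 * L (\<kappa> i) \<le> real (card (D (\<kappa> i)))" using big[of "\<kappa> i"] by (simp only: L_def)
        then have "1 / real (card (D (\<kappa> i))) \<le> 1 / (2 * L (\<kappa> i))"
          using Lpos[of "\<kappa> i"] by (intro divide_left_mono mult_pos_pos) auto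
        then show ?thesis by simp
      qed
    qed simp
    also have "\<dots> = (1/2) ^ n * (\<Prod>i<n. 1 / L (\<kappa> i))"
      by (subst prod.distrib) simp
    also have "(\<Prod>i<n. 1 / L (\<kappa> i)) = L (\<kappa> n) * (\<Prod>i<Suc n. 1 / L (\<kappa> i))"
      using Lpos[of "\<kappa> n"] by simp
    also have "(\<Prod>i<Suc n. 1 / L (\<kappa> i)) = G n powr s"
      unfolding G_def L_def by (subst prod_powr_distrib) (auto simp: powr_divide)
    also have "(1/2) ^ n * (L (\<kappa> n) * G n powr s) \<le> (1/2) ^ n * ((L 0 * 2 ^ n) * G n powr s)"
      using \<kappa>(2)[of n] by (intro mult_left_mono mult_right_mono) auto
    also have "\<dots> = L 0 * G n powr s" by (simp add: power_one_over)
    finally show "(\<Prod>i<n. 1 / real (card (D (\<kappa> i)))) \<le> L 0 * G n powr s" .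
  next
    fix c :: "nat \<Rightarrow> complex" assume c: "\<And>i. c i \<in> D (\<kappa> i)"
    have *: "5 \<le> cmod (c i)" "real (\<kappa> i) \<le> cmod (c i)" "c i \<in> S" for i
      using D(2)[of "\<kappa> i"] D(4)[OF c[of i]] c[of i] by (auto simp: R_def)
    show "cf_value c \<in> hurwitz_F S"
    proof (rule cf_value_in_hurwitz_F[OF *(1,3) S])
      have "filterlim (\<lambda>i. real (\<kappa> i)) at_top sequentially"
        by (rule filterlim_compose[OF filterlim_real_sequentially \<kappa>(1)])
      then show "filterlim (\<lambda>i. cmod (c i)) at_top sequentially"
        by (rule filterlim_at_top_mono) (use *(2) in auto)
    qed
  qed
qed

section \<open>The dimension formula\<close>

theorem theorem1p1:
  fixes S :: "complex set"
  assumes "S \<subseteq> gaussian_integers" and "infinite S"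
  shows "hausdorff_dim (hurwitz_F S) = convergence_exponent (cmod ` S) / 2"
proof (rule antisym)
  let ?\<tau> = "convergence_exponent (cmod ` S)"
  have half_real: "ennreal (2 * r) / 2 = ennreal r" if "0 \<le> r" for r
    using that by (simp add: divide_ennreal flip: ennreal_numeral)
  have "S \<subseteq> (\<Union>n::nat. {c \<in> gaussian_integers. cmod c \<le> real n})"
    using assms(1) real_arch_simple by fastforce
  then have count: "countable S"
    by (rule countable_subset) (auto intro: countable_finite finite_gaussian_integers_bounded)
  show "hausdorff_dim (hurwitz_F S) \<le> ?\<tau> / 2"
  proof -
    have "hausdorff_dim (hurwitz_F S) * 2 \<le> ?\<tau>"
      unfolding convergence_exponent_def
    proof (rule INF_greatest)
      fix t assume "t \<in> {t. 0 \<le> t \<and> (\<lambda>k. k powr - t) summable_on cmod ` S - {0}}"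
      then have t: "0 \<le> t" "(\<lambda>k. k powr - t) summable_on cmod ` S - {0}" by auto
      show "hausdorff_dim (hurwitz_F S) * 2 \<le> ennreal t"
      proof (rule ennreal_le_epsilon)
        fix e :: real assume e: "0 < e"
        \<comment> \<open>the excess of \<open>2 * s\<close> over \<open>t\<close> pays for the multiplicities of the moduli\<close>
        define s where "s = (t + e) / 2"
        have s: "s > 0" "2 * s = t + e" using t(1) e by (auto simp: s_def)
        have "(\<lambda>c. cmod c powr (- (2 * s))) summable_on (S - {0})"
          unfolding s(2) using e
          by (intro summable_gaussian_integers_if_summable_moduli[OF assms(1) t(2)]) simp
        then have "hausdorff_dim (hurwitz_F S) \<le> ennreal s"
          by (rule hausdorff_dim_hurwitz_F_le[OF assms(2) count s(1)])
        then have "hausdorff_dim (hurwitz_F S) * 2 \<le> ennreal s * 2" by (rule mult_right_mono) simp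
        also have "\<dots> = ennreal (t + e)"
          using s by (simp add: mult.commute flip: ennreal_numeral ennreal_mult')
        also have "\<dots> = ennreal t + ennreal e" using t e by simp
        finally show "hausdorff_dim (hurwitz_F S) * 2 \<le> ennreal t + ennreal e" .
      qed
    qed
    then have "hausdorff_dim (hurwitz_F S) * 2 / 2 \<le> ?\<tau> / 2" by (rule divide_right_mono_ennreal)
    then show ?thesis by (simp add: ennreal_mult_divide_eq)
  qed
  show "?\<tau> / 2 \<le> hausdorff_dim (hurwitz_F S)"
    unfolding hausdorff_dim_def
  proof (rule INF_greatest)
    fix s assume "s \<in> {s. 0 \<le> s \<and> hausdorff_measure s (hurwitz_F S) = 0}"
    then have s: "0 \<le> s" "hausdorff_measure s (hurwitz_F S) = 0" by auto
    have "?\<tau> \<le> ennreal (2 * s)"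
    proof (rule ccontr)
      assume "\<not> ?\<tau> \<le> ennreal (2 * s)"
      then have "ennreal (2 * s) < ?\<tau>" by simp
      then obtain x where x: "ennreal (2 * s) < x" "x < ?\<tau>" using dense by blast
      then have "x < top" using less_top by (metis less_trans top_greatest order_less_le_trans)
      then obtain t where t: "0 \<le> t" "x = ennreal t" by (auto simp: less_top_ennreal)
      have "2 * s < t" using x(1) t s by (simp add: ennreal_less_iff)
      moreover have "\<not> (\<lambda>k. k powr (- t)) summable_on (cmod ` S - {0})"
      proof
        assume "(\<lambda>k. k powr (- t)) summable_on (cmod ` S - {0})"
        then have "?\<tau> \<le> ennreal t"
          unfolding convergence_exponent_def using t(1) by (intro INF_lower) simp
        then show False using x(2) t(2) by simp
      qed
      ultimately show False
        using hausdorff_measure_hurwitz_F_pos[OF assms(1) s(1)] s(2) by blast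
    qed
    then have "?\<tau> / 2 \<le> ennreal (2 * s) / 2" by (rule divide_right_mono_ennreal)
    then show "?\<tau> / 2 \<le> ennreal s" using half_real[OF s(1)] by simp
  qed
qed

end
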